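(* Let $G$ be a finite group, let $X,Y$ be finite transitive $G$-sets, let $n\ge 1$, and let $\mathcal O\subseteq X\times Y$ be a $G$-stable irreducible subset. Let $\Delta_*:H^1(G,\mu_n)\to H^1(G,\mu_n[X]\oplus\mu_n[Y])$ be the map induced by the diagonal homomorphism of $G$-modules $\Delta:\mu_n\to\mu_n[X]\oplus\mu_n[Y]$, $\zeta\mapsto(\sum_{x\in X}\zeta[x],\sum_{y\in Y}\zeta[y])$. (a) There is an injection of groups $$H^0(G,\mu_n[\mathcal O])\hookrightarrow \mathbf h^0(G,\mathcal O),$$ and the right hand side equals the closure under $D$-equivalence of the image of the left hand side. (b) There is an injection of groups $$\mathbf h^1(G,\mathcal O)/\mathbf h^0(G,\mathcal O)\hookrightarrow H^1(G,\mu_n[X]\oplus\mu_n[Y])/\Delta_*H^1(G,\mu_n),$$ and the image is generated by the classes in $H^1(G,\mu_n[X]\oplus\mu_n[Y])$ that yield monomial covers for which all $G$-orbits in $\mathcal O$ are orientable.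
   Context: $\mu_n\subset\mathbb C^\times$ is the group of complex $n$-th roots of unity (with trivial $G$-action), $\mu_n^+=\{0\}\cup\mu_n$. An $X\times Y$ matrix over $\mu_n^+$ is a function $A:X\times Y\to\mu_n^+$; its support is $\{(x,y):A_{x,y}\ne0\}$. $G$ acts on such matrices by $(gA)_{x,y}=A_{g^{-1}x,g^{-1}y}$. A subset $\mathcal O\subseteq X\times Y$ is irreducible if the bipartite graph on $X\sqcup Y$ with an edge $\{x,y\}$ for every $(x,y)\in\mathcal O$ is connected. $D_X$ (resp. $D_Y$) is the group of diagonal matrices indexed by $X$ (resp. $Y$) with diagonal entries in $\mu_n$. For a finite $G$-set $S$, $\mu_n[S]$ is the abelian group of formal sums $\sum_{s\in S}\zeta_s[s]$ with $\zeta_s\in\mu_n$ (coefficientwise multiplication in $\mu_n$), with $G$ permuting the basis; $D_X=\mu_n[X]$ and $D_Y=\mu_n[Y]$ as $G$-modules, via $\mathrm{diag}(v)\mapsto\sum_s v_s[s]$. $H^0(G,M)=M^G$, and $H^1(G,M)$ is ordinary group cohomology (crossed homomorphisms $z(g_1g_2)=z(g_1)+g_1z(g_2)$ modulo $g\mapsto gm-m$). $\mathrm{Mon}(S,\mu_n)$ is the group of monomial matrices indexed by $S$ with nonzero entries in $\mu_n$; $p_X(g),p_Y(g)$ are the permutation matrices of $g\in G$ on $X,Y$. A monomial cover with $\widetilde G=G$ is a homomorphism $s=(P,Q):G\to \mathrm{Mon}(X,\mu_n)\times \mathrm{Mon}(Y,\mu_n)$ with $|P(g)|=p_X(g)$,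 $|Q(g)|=p_Y(g)$ (entrywise absolute values). A 1-cocycle $c=(c_X,c_Y)$ with values in $\mu_n[X]\oplus\mu_n[Y]=D_X\times D_Y$ yields the monomial cover $P(g)=c_X(g)p_X(g)$, $Q(g)=c_Y(g)p_Y(g)$; cohomologous cocycles yield $D_X\times D_Y$-conjugate covers. For a monomial matrix $P$, $\mathrm{sign}(s,P)$ is the unique nonzero entry of $P$ in row $s$. A pair $(x,y)$ is orientable for the cover if $\mathrm{sign}(x,P(g))=\mathrm{sign}(y,Q(g))$ for all $g\in G$ with $gx=x$, $gy=y$; this depends only on the $G$-orbit of $(x,y)$, and an orbit is orientable if its points are. Two matrices $A,B$ are $D$-equivalent if $A=LBR^*$ with $L\in D_X$, $R\in D_Y$ ($*$ is conjugate-transpose). The following sets are abelian groups under the Hadamard (entrywise) product, with neutral element the characteristic matrix of $\mathcal O$: $\mathbf h(G,\mathcal O)$, the set of $X\times Y$ matrices $A$ over $\mu_n^+$ with support exactly $\mathcal O$ such that for every $g\in G$ there are $L(g)\in D_X$, $R(g)\in D_Y$ with $A=L(g)(gA)R(g)^*$; $\mathbf h^0(G,\mathcal O)$, the set of $A\in\mathbf h(G,\mathcal O)$ that are $D$-equivalent to some $B$ with $gB=B$ for all $g\in G$; $\mathbf h^1(G,\mathcal O)$, the set of $A\in\mathbf h(G,\mathcal O)$ for which there is a monomial cover $(P,Q)$ with $\widetilde G=G$ satisfying $P(g)AQ(g)^*=A$ for all $g\in G$. *)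

theory Defs
  imports
    Complex_Main
    "HOL-Algebra.Group_Action"
    "HOL-Algebra.Generated_Groups"
    "HOL-Algebra.Product_Groups"
    "Graph_Theory.Digraph_Component"
begin

section \<open>Low-degree cohomology of a finite group\<close>

text \<open>
  A $G$-module is a multiplicatively written abelian group \<open>M\<close> together with an action
  \<open>act :: 'g \<Rightarrow> 'm \<Rightarrow> 'm\<close>. Cochains are extensional functions on \<open>carrier G\<close>.
\<close>

definition H0 :: "('g, 'a) monoid_scheme \<Rightarrow> 'm monoid \<Rightarrow> ('g \<Rightarrow> 'm \<Rightarrow> 'm) \<Rightarrow> 'm monoid" where
  "H0 G M act = M\<lparr>carrier := {m \<in> carrier M. \<forall>g \<in> carrier G. act g m = m}\<rparr>"

definition Z1 ::
  "('g, 'a) monoid_scheme \<Rightarrow> 'm monoid \<Rightarrow> ('g \<Rightarrow> 'm \<Rightarrow> 'm) \<Rightarrow> ('g \<Rightarrow> 'm) monoid" where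
  "Z1 G M act = (product_group (carrier G) (\<lambda>_. M))
     \<lparr>carrier := {z \<in> carrier G \<rightarrow>\<^sub>E carrier M.
        \<forall>g \<in> carrier G. \<forall>h \<in> carrier G. z (g \<otimes>\<^bsub>G\<^esub> h) = z g \<otimes>\<^bsub>M\<^esub> act g (z h)}\<rparr>"

definition B1 ::
  "('g, 'a) monoid_scheme \<Rightarrow> 'm monoid \<Rightarrow> ('g \<Rightarrow> 'm \<Rightarrow> 'm) \<Rightarrow> ('g \<Rightarrow> 'm) set" where
  "B1 G M act = (\<lambda>m. \<lambda>g \<in> carrier G. act g m \<otimes>\<^bsub>M\<^esub> inv\<^bsub>M\<^esub> m) ` carrier M"

definition H1 ::
  "('g, 'a) monoid_scheme \<Rightarrow> 'm monoid \<Rightarrow> ('g \<Rightarrow> 'm \<Rightarrow> 'm) \<Rightarrow> ('g \<Rightarrow> 'm) set monoid" where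
  "H1 G M act = Z1 G M act Mod B1 G M act"

text \<open>
  The map $H^1(G,M) \to H^1(G,N)$ induced by an equivariant homomorphism \<open>f\<close>. Classes are
  cosets, and composing all cocycles of a class with \<open>f\<close> gives a subset of a single coset of
  the coboundaries of \<open>N\<close>; multiplying by the coboundaries yields that whole coset.
\<close>

definition H1_map ::
  "('g, 'a) monoid_scheme \<Rightarrow> 'n monoid \<Rightarrow> ('g \<Rightarrow> 'n \<Rightarrow> 'n) \<Rightarrow> ('m \<Rightarrow> 'n) \<Rightarrow>
   ('g \<Rightarrow> 'm) set \<Rightarrow> ('g \<Rightarrow> 'n) set" where
  "H1_map G N act f C =
     B1 G N act <#>\<^bsub>Z1 G N act\<^esub> ((\<lambda>z. \<lambda>g \<in> carrier G. f (z g)) ` C)"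


section \<open>Roots of unity and the modules they form\<close>

definition mu :: "nat \<Rightarrow> complex set" where
  "mu n = {z. z ^ n = 1}"

definition mu_plus :: "nat \<Rightarrow> complex set" where
  "mu_plus n = insert 0 (mu n)"

definition mu_group :: "nat \<Rightarrow> complex monoid" where
  "mu_group n = \<lparr>carrier = mu n, monoid.mult = (*), one = 1\<rparr>"

definition trivial_act :: "'g \<Rightarrow> 'm \<Rightarrow> 'm" where
  "trivial_act g m = m"

text \<open>
  The formal sum $\sum_{s} v_s [s]$ is the extensional function \<open>v\<close> on \<open>S\<close>. Since $g$ sends it
  to $\sum_s v_s [gs]$, the new coefficient at $s$ is $v_{g^{-1}s}$.
\<close>

definition mu_perm :: "nat \<Rightarrow> 's set \<Rightarrow> ('s \<Rightarrow> complex) monoid" where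
  "mu_perm n S = product_group S (\<lambda>_. mu_group n)"

definition perm_act ::
  "('g, 'a) monoid_scheme \<Rightarrow> 's set \<Rightarrow> ('g \<Rightarrow> 's \<Rightarrow> 's) \<Rightarrow> 'g \<Rightarrow> ('s \<Rightarrow> complex) \<Rightarrow> 's \<Rightarrow> complex" where
  "perm_act G S \<phi> g v = (\<lambda>s \<in> S. v (\<phi> (inv\<^bsub>G\<^esub> g) s))"

definition pair_act :: "('g \<Rightarrow> 'x \<Rightarrow> 'x) \<Rightarrow> ('g \<Rightarrow> 'y \<Rightarrow> 'y) \<Rightarrow> 'g \<Rightarrow> 'x \<times> 'y \<Rightarrow> 'x \<times> 'y" where
  "pair_act \<phi> \<psi> g = map_prod (\<phi> g) (\<psi> g)"

definition mu_sum :: "nat \<Rightarrow> 'x set \<Rightarrow> 'y set \<Rightarrow> (('x \<Rightarrow> complex) \<times> ('y \<Rightarrow> complex)) monoid" where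
  "mu_sum n X Y = mu_perm n X \<times>\<times> mu_perm n Y"

definition sum_act ::
  "('g, 'a) monoid_scheme \<Rightarrow> 'x set \<Rightarrow> ('g \<Rightarrow> 'x \<Rightarrow> 'x) \<Rightarrow> 'y set \<Rightarrow> ('g \<Rightarrow> 'y \<Rightarrow> 'y) \<Rightarrow>
   'g \<Rightarrow> ('x \<Rightarrow> complex) \<times> ('y \<Rightarrow> complex) \<Rightarrow> ('x \<Rightarrow> complex) \<times> ('y \<Rightarrow> complex)" where
  "sum_act G X \<phi> Y \<psi> g = map_prod (perm_act G X \<phi> g) (perm_act G Y \<psi> g)"

definition Delta :: "'x set \<Rightarrow> 'y set \<Rightarrow> complex \<Rightarrow> ('x \<Rightarrow> complex) \<times> ('y \<Rightarrow> complex)" where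
  "Delta X Y \<zeta> = (\<lambda>x \<in> X. \<zeta>, \<lambda>y \<in> Y. \<zeta>)"

definition Delta_image ::
  "('g, 'a) monoid_scheme \<Rightarrow> nat \<Rightarrow> 'x set \<Rightarrow> ('g \<Rightarrow> 'x \<Rightarrow> 'x) \<Rightarrow> 'y set \<Rightarrow> ('g \<Rightarrow> 'y \<Rightarrow> 'y) \<Rightarrow>
   ('g \<Rightarrow> ('x \<Rightarrow> complex) \<times> ('y \<Rightarrow> complex)) set set" where
  "Delta_image G n X \<phi> Y \<psi> =
     H1_map G (mu_sum n X Y) (sum_act G X \<phi> Y \<psi>) (Delta X Y) `
       carrier (H1 G (mu_group n) trivial_act)"


section \<open>Matrices\<close>

text \<open>
  An $X \times Y$ matrix is a function \<open>'x \<Rightarrow> 'y \<Rightarrow> complex\<close> that vanishes outside $X \times Y$.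
\<close>

definition mmult :: "'y set \<Rightarrow> ('x \<Rightarrow> 'y \<Rightarrow> complex) \<Rightarrow> ('y \<Rightarrow> 'z \<Rightarrow> complex) \<Rightarrow> 'x \<Rightarrow> 'z \<Rightarrow> complex" where
  "mmult Y A B = (\<lambda>x z. \<Sum>y \<in> Y. A x y * B y z)"

definition ctranspose :: "('x \<Rightarrow> 'y \<Rightarrow> complex) \<Rightarrow> 'y \<Rightarrow> 'x \<Rightarrow> complex" where
  "ctranspose A = (\<lambda>y x. cnj (A x y))"

definition mu_matrices :: "nat \<Rightarrow> 'x set \<Rightarrow> 'y set \<Rightarrow> ('x \<Rightarrow> 'y \<Rightarrow> complex) set" where
  "mu_matrices n X Y =
     {A. (\<forall>x \<in> X. \<forall>y \<in> Y. A x y \<in> mu_plus n) \<and> (\<forall>x y. (x, y) \<notin> X \<times> Y \<longrightarrow> A x y = 0)}"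

definition supp :: "('x \<Rightarrow> 'y \<Rightarrow> complex) \<Rightarrow> ('x \<times> 'y) set" where
  "supp A = {(x, y). A x y \<noteq> 0}"

definition mat_act ::
  "('g, 'a) monoid_scheme \<Rightarrow> 'x set \<Rightarrow> ('g \<Rightarrow> 'x \<Rightarrow> 'x) \<Rightarrow> 'y set \<Rightarrow> ('g \<Rightarrow> 'y \<Rightarrow> 'y) \<Rightarrow>
   'g \<Rightarrow> ('x \<Rightarrow> 'y \<Rightarrow> complex) \<Rightarrow> 'x \<Rightarrow> 'y \<Rightarrow> complex" where
  "mat_act G X \<phi> Y \<psi> g A =
     (\<lambda>x y. if x \<in> X \<and> y \<in> Y then A (\<phi> (inv\<^bsub>G\<^esub> g) x) (\<psi> (inv\<^bsub>G\<^esub> g) y) else 0)"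

definition diag_matrix :: "'s set \<Rightarrow> ('s \<Rightarrow> complex) \<Rightarrow> 's \<Rightarrow> 's \<Rightarrow> complex" where
  "diag_matrix S v = (\<lambda>s t. if s \<in> S \<and> s = t then v s else 0)"

definition diag_group :: "nat \<Rightarrow> 's set \<Rightarrow> ('s \<Rightarrow> 's \<Rightarrow> complex) set" where
  "diag_group n S = {diag_matrix S v | v. v \<in> S \<rightarrow> mu n}"

definition D_equiv ::
  "nat \<Rightarrow> 'x set \<Rightarrow> 'y set \<Rightarrow> ('x \<Rightarrow> 'y \<Rightarrow> complex) \<Rightarrow> ('x \<Rightarrow> 'y \<Rightarrow> complex) \<Rightarrow> bool" where
  "D_equiv n X Y A B \<longleftrightarrow>
     (\<exists>L \<in> diag_group n X. \<exists>R \<in> diag_group n Y. A = mmult Y (mmult X L B) (ctranspose R))"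

definition perm_matrix :: "'s set \<Rightarrow> ('g \<Rightarrow> 's \<Rightarrow> 's) \<Rightarrow> 'g \<Rightarrow> 's \<Rightarrow> 's \<Rightarrow> complex" where
  "perm_matrix S \<phi> g = (\<lambda>s t. if s \<in> S \<and> t \<in> S \<and> s = \<phi> g t then 1 else 0)"

definition Mon :: "nat \<Rightarrow> 's set \<Rightarrow> ('s \<Rightarrow> 's \<Rightarrow> complex) monoid" where
  "Mon n S = \<lparr>carrier = {P \<in> mu_matrices n S S.
                (\<forall>s \<in> S. \<exists>!t. t \<in> S \<and> P s t \<noteq> 0) \<and> (\<forall>t \<in> S. \<exists>!s. s \<in> S \<and> P s t \<noteq> 0)},
              monoid.mult = mmult S, one = diag_matrix S (\<lambda>_. 1)\<rparr>"

definition entry_abs :: "('s \<Rightarrow> 't \<Rightarrow> complex) \<Rightarrow> 's \<Rightarrow> 't \<Rightarrow> complex" where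
  "entry_abs P = (\<lambda>s t. complex_of_real (cmod (P s t)))"

definition row_sign :: "'s \<Rightarrow> ('s \<Rightarrow> 's \<Rightarrow> complex) \<Rightarrow> complex" where
  "row_sign s P = (THE z. z \<noteq> 0 \<and> (\<exists>t. P s t = z))"


section \<open>Monomial covers and orientability\<close>

definition monomial_cover ::
  "('g, 'a) monoid_scheme \<Rightarrow> nat \<Rightarrow> 'x set \<Rightarrow> ('g \<Rightarrow> 'x \<Rightarrow> 'x) \<Rightarrow> 'y set \<Rightarrow> ('g \<Rightarrow> 'y \<Rightarrow> 'y) \<Rightarrow>
   ('g \<Rightarrow> ('x \<Rightarrow> 'x \<Rightarrow> complex) \<times> ('y \<Rightarrow> 'y \<Rightarrow> complex)) \<Rightarrow> bool" where
  "monomial_cover G n X \<phi> Y \<psi> s \<longleftrightarrow>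
     s \<in> hom G (Mon n X \<times>\<times> Mon n Y) \<and>
     (\<forall>g \<in> carrier G. entry_abs (fst (s g)) = perm_matrix X \<phi> g \<and>
                      entry_abs (snd (s g)) = perm_matrix Y \<psi> g)"

definition cover_of_cocycle ::
  "'x set \<Rightarrow> ('g \<Rightarrow> 'x \<Rightarrow> 'x) \<Rightarrow> 'y set \<Rightarrow> ('g \<Rightarrow> 'y \<Rightarrow> 'y) \<Rightarrow>
   ('g \<Rightarrow> ('x \<Rightarrow> complex) \<times> ('y \<Rightarrow> complex)) \<Rightarrow>
   'g \<Rightarrow> ('x \<Rightarrow> 'x \<Rightarrow> complex) \<times> ('y \<Rightarrow> 'y \<Rightarrow> complex)" where
  "cover_of_cocycle X \<phi> Y \<psi> c = (\<lambda>g.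
     (mmult X (diag_matrix X (fst (c g))) (perm_matrix X \<phi> g),
      mmult Y (diag_matrix Y (snd (c g))) (perm_matrix Y \<psi> g)))"

definition orientable ::
  "('g, 'a) monoid_scheme \<Rightarrow> ('g \<Rightarrow> 'x \<Rightarrow> 'x) \<Rightarrow> ('g \<Rightarrow> 'y \<Rightarrow> 'y) \<Rightarrow>
   ('g \<Rightarrow> ('x \<Rightarrow> 'x \<Rightarrow> complex) \<times> ('y \<Rightarrow> 'y \<Rightarrow> complex)) \<Rightarrow> 'x \<times> 'y \<Rightarrow> bool" where
  "orientable G \<phi> \<psi> s = (\<lambda>(x, y).
     \<forall>g \<in> carrier G. \<phi> g x = x \<and> \<psi> g y = y \<longrightarrow>
       row_sign x (fst (s g)) = row_sign y (snd (s g)))"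

definition orbit_orientable ::
  "('g, 'a) monoid_scheme \<Rightarrow> ('g \<Rightarrow> 'x \<Rightarrow> 'x) \<Rightarrow> ('g \<Rightarrow> 'y \<Rightarrow> 'y) \<Rightarrow>
   ('g \<Rightarrow> ('x \<Rightarrow> 'x \<Rightarrow> complex) \<times> ('y \<Rightarrow> 'y \<Rightarrow> complex)) \<Rightarrow> ('x \<times> 'y) set \<Rightarrow> bool" where
  "orbit_orientable G \<phi> \<psi> s orb \<longleftrightarrow> (\<forall>p \<in> orb. orientable G \<phi> \<psi> s p)"

definition orientable_classes ::
  "('g, 'a) monoid_scheme \<Rightarrow> nat \<Rightarrow> 'x set \<Rightarrow> ('g \<Rightarrow> 'x \<Rightarrow> 'x) \<Rightarrow> 'y set \<Rightarrow> ('g \<Rightarrow> 'y \<Rightarrow> 'y) \<Rightarrow>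
   ('x \<times> 'y) set \<Rightarrow> ('g \<Rightarrow> ('x \<Rightarrow> complex) \<times> ('y \<Rightarrow> complex)) set set" where
  "orientable_classes G n X \<phi> Y \<psi> \<O> =
     {C \<in> carrier (H1 G (mu_sum n X Y) (sum_act G X \<phi> Y \<psi>)).
        \<forall>c \<in> C. \<forall>orb \<in> orbits G \<O> (pair_act \<phi> \<psi>).
          orbit_orientable G \<phi> \<psi> (cover_of_cocycle X \<phi> Y \<psi> c) orb}"


section \<open>Irreducible subsets and the groups $\mathbf h$, $\mathbf h^0$, $\mathbf h^1$\<close>

text \<open>\<^const>\<open>connected\<close> refers to the underlying undirected graph.\<close>

definition bipartite_graph ::
  "'x set \<Rightarrow> 'y set \<Rightarrow> ('x \<times> 'y) set \<Rightarrow> ('x + 'y) pair_pre_digraph" where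
  "bipartite_graph X Y \<O> = \<lparr>pverts = X <+> Y, parcs = {(Inl x, Inr y) | x y. (x, y) \<in> \<O>}\<rparr>"

definition irreducible_subset :: "'x set \<Rightarrow> 'y set \<Rightarrow> ('x \<times> 'y) set \<Rightarrow> bool" where
  "irreducible_subset X Y \<O> \<longleftrightarrow>
     \<O> \<subseteq> X \<times> Y \<and> Digraph_Component.connected (with_proj (bipartite_graph X Y \<O>))"

definition G_stable ::
  "('g, 'a) monoid_scheme \<Rightarrow> ('g \<Rightarrow> 'x \<Rightarrow> 'x) \<Rightarrow> ('g \<Rightarrow> 'y \<Rightarrow> 'y) \<Rightarrow> ('x \<times> 'y) set \<Rightarrow> bool" where
  "G_stable G \<phi> \<psi> \<O> \<longleftrightarrow> (\<forall>g \<in> carrier G. pair_act \<phi> \<psi> g ` \<O> \<subseteq> \<O>)"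

definition hh ::
  "('g, 'a) monoid_scheme \<Rightarrow> nat \<Rightarrow> 'x set \<Rightarrow> ('g \<Rightarrow> 'x \<Rightarrow> 'x) \<Rightarrow> 'y set \<Rightarrow> ('g \<Rightarrow> 'y \<Rightarrow> 'y) \<Rightarrow>
   ('x \<times> 'y) set \<Rightarrow> ('x \<Rightarrow> 'y \<Rightarrow> complex) monoid" where
  "hh G n X \<phi> Y \<psi> \<O> =
     \<lparr>carrier = {A \<in> mu_matrices n X Y. supp A = \<O> \<and>
        (\<forall>g \<in> carrier G. \<exists>L \<in> diag_group n X. \<exists>R \<in> diag_group n Y.
           A = mmult Y (mmult X L (mat_act G X \<phi> Y \<psi> g A)) (ctranspose R))},
      monoid.mult = (\<lambda>A B x y. A x y * B x y),
      one = (\<lambda>x y. of_bool ((x, y) \<in> \<O>))\<rparr>"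

definition hh0 ::
  "('g, 'a) monoid_scheme \<Rightarrow> nat \<Rightarrow> 'x set \<Rightarrow> ('g \<Rightarrow> 'x \<Rightarrow> 'x) \<Rightarrow> 'y set \<Rightarrow> ('g \<Rightarrow> 'y \<Rightarrow> 'y) \<Rightarrow>
   ('x \<times> 'y) set \<Rightarrow> ('x \<Rightarrow> 'y \<Rightarrow> complex) monoid" where
  "hh0 G n X \<phi> Y \<psi> \<O> = (hh G n X \<phi> Y \<psi> \<O>)
     \<lparr>carrier := {A \<in> carrier (hh G n X \<phi> Y \<psi> \<O>).
        \<exists>B \<in> mu_matrices n X Y. D_equiv n X Y A B \<and>
          (\<forall>g \<in> carrier G. mat_act G X \<phi> Y \<psi> g B = B)}\<rparr>"

definition hh1 ::
  "('g, 'a) monoid_scheme \<Rightarrow> nat \<Rightarrow> 'x set \<Rightarrow> ('g \<Rightarrow> 'x \<Rightarrow> 'x) \<Rightarrow> 'y set \<Rightarrow> ('g \<Rightarrow> 'y \<Rightarrow> 'y) \<Rightarrow>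
   ('x \<times> 'y) set \<Rightarrow> ('x \<Rightarrow> 'y \<Rightarrow> complex) monoid" where
  "hh1 G n X \<phi> Y \<psi> \<O> = (hh G n X \<phi> Y \<psi> \<O>)
     \<lparr>carrier := {A \<in> carrier (hh G n X \<phi> Y \<psi> \<O>).
        \<exists>s. monomial_cover G n X \<phi> Y \<psi> s \<and>
          (\<forall>g \<in> carrier G.
             mmult Y (mmult X (fst (s g)) A) (ctranspose (snd (s g))) = A)}\<rparr>"

end

theory Submission
  imports Defs
begin

text \<open>
  The proof attaches cocycles to matrices. Say that a matrix $A$ with support $\mathcal O$ is
  twisted by a cocycle $c = (c_X, c_Y)$ with values in $\mu_n[X] \oplus \mu_n[Y]$ if
  $A_{x,y} = c_X(g)_x \, A_{g^{-1}x, g^{-1}y} \, \overline{c_Y(g)_y}$ for all $g$, $x$, $y$, that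
  is, if $A$ is fixed by the monomial cover that $c$ yields. Every monomial cover comes from a
  cocycle (\<open>cocycle_of_monomial_cover\<close>), so $\mathbf h^1$ consists of the matrices twisted by some
  cocycle. Rescaling rows and columns changes the cocycle by a coboundary, so $\mathbf h^0$
  consists of the matrices twisted by a coboundary (\<open>D_equiv_invariant_iff\<close>).

  How far does $A$ determine $c$? If $c$ and $d$ twist the same matrix, their quotient twists the
  characteristic matrix of $\mathcal O$. Then the $X$-component and the $Y$-component of the quotient
  agree along each edge of the bipartite graph, which is connected, so both are equal to one
  constant for each $g$: the quotient is a homomorphism $G \to \mu_n$ placed diagonally
  (\<open>twisted_one_imp_push\<close>). Hence the class of $c$ modulo the image of $\Delta_*$ depends only on
  $A$, and $A \mapsto [c]$ is a homomorphism on $\mathbf h^1$. Its kernel is $\mathbf h^0$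
  (\<open>kernel_kappa\<close>), and the first isomorphism theorem gives the injection of the second part.

  For the image, let $g$ fix a point $(x,y)$ of $\mathcal O$. The twisting equation there says
  $c_X(g)_x = c_Y(g)_y$, which is orientability. Conversely, for an orientable cocycle $c$ the
  products $c_X(g)_x \overline{c_Y(g)_y}$ form a cocycle with values in $\mu_n[\mathcal O]$ that is
  trivial on stabilizers; by Shapiro's lemma in degree one it is a coboundary, which means that
  $c$ twists some matrix (\<open>orientable_imp_twisted\<close>). So the image is exactly the set of orientable
  classes. In particular this set is a subgroup and coincides with the subgroup that it
  generates.

  In the first part, extending an invariant formal sum over $\mathcal O$ by zero identifies
  $H^0(G, \mu_n[\mathcal O])$ with the $G$-invariant matrices of support $\mathcal O$, and a matrix
  that is $D$-equivalent to one over $\mu_n^+$ has the same support.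
\<close>

section \<open>Products, subgroups and quotients of groups\<close>

lemma (in comm_group) comm_group_subgroup:
  assumes "subgroup H G"
  shows "comm_group (G\<lparr>carrier := H\<rparr>)"
proof -
  interpret K: group "G\<lparr>carrier := H\<rparr>"
    using assms subgroup.subgroup_is_group is_group by blast
  show ?thesis
    using subgroup.subset[OF assms] by (intro K.group_comm_groupI) (auto simp: m_comm subset_iff)
qed

lemma comm_group_product_group:
  assumes "\<And>i. i \<in> I \<Longrightarrow> comm_group (M i)"
  shows "comm_group (product_group I M)"
proof (rule group.group_comm_groupI)
  show "Group.group (product_group I M)"
    using assms by (simp add: comm_group.axioms)
  show "x \<otimes>\<^bsub>product_group I M\<^esub> y = y \<otimes>\<^bsub>product_group I M\<^esub> x"
    if "x \<in> carrier (product_group I M)" "y \<in> carrier (product_group I M)" for x y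
    using that assms by (auto simp: PiE_iff comm_group_def comm_monoid.m_comm intro!: restrict_ext)
qed

lemma comm_group_DirProd:
  assumes "comm_group M" "comm_group N"
  shows "comm_group (M \<times>\<times> N)"
proof (rule group.group_comm_groupI)
  interpret M: comm_group M by fact
  interpret N: comm_group N by fact
  show "Group.group (M \<times>\<times> N)"
    by (simp add: DirProd_group M.is_group N.is_group)
  fix x y assume "x \<in> carrier (M \<times>\<times> N)" "y \<in> carrier (M \<times>\<times> N)"
  then obtain a b c d where "x = (a,b)" "y = (c,d)" "a \<in> carrier M" "c \<in> carrier M" "b \<in> carrier N" "d \<in> carrier N"
    by (auto simp: DirProd_def)
  moreover from this have "a \<otimes>\<^bsub>M\<^esub> c = c \<otimes>\<^bsub>M\<^esub> a" "b \<otimes>\<^bsub>N\<^esub> d = d \<otimes>\<^bsub>N\<^esub> b"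
    by (auto intro: M.m_comm N.m_comm)
  ultimately show "x \<otimes>\<^bsub>M \<times>\<times> N\<^esub> y = y \<otimes>\<^bsub>M \<times>\<times> N\<^esub> x"
    by simp
qed

lemma (in group) generate_subgroup:
  assumes "subgroup H G"
  shows "generate G H = H"
proof
  show "generate G H \<subseteq> H"
    using subset_refl assms by (rule generate_subgroup_incl)
  show "H \<subseteq> generate G H"
    by (rule subsetI) (rule generate.incl)
qed

lemma (in group_hom) image_FactGroup_kernel:
  "(\<lambda>C. the_elem (h ` C)) ` carrier (G Mod kernel G H h) = h ` carrier G"
proof -
  have "h ` (kernel G H h #>\<^bsub>G\<^esub> x) = {h x}" if x: "x \<in> carrier G" for x
  proof -
    have const: "h y = h x" if "y \<in> kernel G H h #>\<^bsub>G\<^esub> x" for y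
      using that x by (auto simp: r_coset_def kernel_def)
    have "{h x} \<subseteq> h ` (kernel G H h #>\<^bsub>G\<^esub> x)"
      using G.rcos_self[OF x subgroup_kernel] by simp
    moreover have "h ` (kernel G H h #>\<^bsub>G\<^esub> x) \<subseteq> {h x}"
      by (rule image_subsetI, unfold singleton_iff, rule const)
    ultimately show ?thesis by (rule equalityI[rotated])
  qed
  then show ?thesis
    by (simp add: carrier_FactGroup image_image cong: image_cong_simp)
qed

section \<open>Modules over a group and their first cohomology\<close>

locale g_module = G: group G + M: comm_group M
  for G :: "('g, 'a) monoid_scheme" and M :: "'m monoid" +
  fixes act :: "'g \<Rightarrow> 'm \<Rightarrow> 'm"
  assumes act_hom: "g \<in> carrier G \<Longrightarrow> act g \<in> hom M M"
    and act_mult: "\<lbrakk>g \<in> carrier G; h \<in> carrier G; m \<in> carrier M\<rbrakk>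
      \<Longrightarrow> act (g \<otimes>\<^bsub>G\<^esub> h) m = act g (act h m)"
begin

lemma act_closed [simp]: "g \<in> carrier G \<Longrightarrow> m \<in> carrier M \<Longrightarrow> act g m \<in> carrier M"
  by (rule hom_in_carrier[OF act_hom])

lemma act_m: "\<lbrakk>g \<in> carrier G; a \<in> carrier M; b \<in> carrier M\<rbrakk>
    \<Longrightarrow> act g (a \<otimes>\<^bsub>M\<^esub> b) = act g a \<otimes>\<^bsub>M\<^esub> act g b"
  by (rule hom_mult[OF act_hom])

lemma act_group_hom: "g \<in> carrier G \<Longrightarrow> group_hom M M (act g)"
  by (simp add: M.is_group act_hom group_hom.intro group_hom_axioms.intro)

lemma act_one: "g \<in> carrier G \<Longrightarrow> act g \<one>\<^bsub>M\<^esub> = \<one>\<^bsub>M\<^esub>"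
  by (rule group_hom.hom_one[OF act_group_hom])

lemma act_inv: "g \<in> carrier G \<Longrightarrow> m \<in> carrier M \<Longrightarrow> act g (inv\<^bsub>M\<^esub> m) = inv\<^bsub>M\<^esub> (act g m)"
  by (rule group_hom.hom_inv[OF act_group_hom])

abbreviation "Z \<equiv> Z1 G M act"
abbreviation "B \<equiv> B1 G M act"
abbreviation "cochains \<equiv> product_group (carrier G) (\<lambda>_. M)"

lemma group_H0: "Group.group (H0 G M act)"
  unfolding H0_def
proof (rule subgroup.subgroup_is_group)
  show "subgroup {m \<in> carrier M. \<forall>g\<in>carrier G. act g m = m} M"
    by (rule M.subgroupI) (auto simp: act_one act_inv act_m)
qed (rule M.is_group)

lemma comm_group_cochains: "comm_group cochains"
  by (rule comm_group_product_group) (rule M.comm_group_axioms)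

lemma carrier_Z:
  "carrier Z = {z \<in> carrier G \<rightarrow>\<^sub>E carrier M.
     \<forall>g \<in> carrier G. \<forall>h \<in> carrier G. z (g \<otimes>\<^bsub>G\<^esub> h) = z g \<otimes>\<^bsub>M\<^esub> act g (z h)}"
  by (simp add: Z1_def)

lemma mult_Z: "y \<otimes>\<^bsub>Z\<^esub> z = (\<lambda>g\<in>carrier G. y g \<otimes>\<^bsub>M\<^esub> z g)"
  by (simp add: Z1_def)

lemma cocycle_closed [simp]: "z \<in> carrier Z \<Longrightarrow> g \<in> carrier G \<Longrightarrow> z g \<in> carrier M"
  by (auto simp: carrier_Z)

lemma cocycle_mult:
  "\<lbrakk>z \<in> carrier Z; g \<in> carrier G; h \<in> carrier G\<rbrakk> \<Longrightarrow> z (g \<otimes>\<^bsub>G\<^esub> h) = z g \<otimes>\<^bsub>M\<^esub> act g (z h)"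
  by (simp add: carrier_Z)

lemma cocycleI:
  assumes "z \<in> extensional (carrier G)" "\<And>g. g \<in> carrier G \<Longrightarrow> z g \<in> carrier M"
    and "\<And>g h. \<lbrakk>g \<in> carrier G; h \<in> carrier G\<rbrakk> \<Longrightarrow> z (g \<otimes>\<^bsub>G\<^esub> h) = z g \<otimes>\<^bsub>M\<^esub> act g (z h)"
  shows "z \<in> carrier Z"
  using assms unfolding carrier_Z PiE_def by blast

lemma subgroup_Z: "subgroup (carrier Z) cochains"
proof -
  interpret C: comm_group cochains by (rule comm_group_cochains)
  have swap: "(a \<otimes>\<^bsub>M\<^esub> b) \<otimes>\<^bsub>M\<^esub> (c \<otimes>\<^bsub>M\<^esub> d) = (a \<otimes>\<^bsub>M\<^esub> c) \<otimes>\<^bsub>M\<^esub> (b \<otimes>\<^bsub>M\<^esub> d)"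
    if "a \<in> carrier M" "b \<in> carrier M" "c \<in> carrier M" "d \<in> carrier M" for a b c d
    using that by (simp add: M.m_ac)
  have inv: "inv\<^bsub>cochains\<^esub> z = (\<lambda>g\<in>carrier G. inv\<^bsub>M\<^esub> z g)" if "z \<in> carrier Z" for z
    using that by (intro inv_product_group) (auto simp: carrier_Z M.is_group)
  show ?thesis
  proof (rule C.subgroupI)
    show "carrier Z \<subseteq> carrier cochains" by (auto simp: carrier_Z)
    have "(\<lambda>g\<in>carrier G. \<one>\<^bsub>M\<^esub>) \<in> carrier Z" by (auto simp: carrier_Z act_one)
    then show "carrier Z \<noteq> {}" by blast
    show "inv\<^bsub>cochains\<^esub> z \<in> carrier Z" if z: "z \<in> carrier Z" for z
    proof -
      have "inv\<^bsub>M\<^esub> z (g \<otimes>\<^bsub>G\<^esub> h) = inv\<^bsub>M\<^esub> z g \<otimes>\<^bsub>M\<^esub> act g (inv\<^bsub>M\<^esub> z h)"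
        if "g \<in> carrier G" "h \<in> carrier G" for g h
        using z that cocycle_mult[OF z that] by (simp add: act_inv M.inv_mult)
      with z show ?thesis
        unfolding inv[OF z] by (intro cocycleI) simp_all
    qed
    show "y \<otimes>\<^bsub>cochains\<^esub> z \<in> carrier Z" if "y \<in> carrier Z" "z \<in> carrier Z" for y z
    proof (rule cocycleI)
      show "(y \<otimes>\<^bsub>cochains\<^esub> z) (g \<otimes>\<^bsub>G\<^esub> h) = (y \<otimes>\<^bsub>cochains\<^esub> z) g \<otimes>\<^bsub>M\<^esub> act g ((y \<otimes>\<^bsub>cochains\<^esub> z) h)"
        if "g \<in> carrier G" "h \<in> carrier G" for g h
        using that \<open>y \<in> carrier Z\<close> \<open>z \<in> carrier Z\<close> by (simp add: cocycle_mult act_m swap)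
    qed (use that in simp_all)
  qed
qed

sublocale Z: comm_group Z
proof -
  interpret C: comm_group cochains by (rule comm_group_cochains)
  show "comm_group Z"
    using C.comm_group_subgroup[OF subgroup_Z] by (simp add: Z1_def)
qed

lemma one_Z: "\<one>\<^bsub>Z\<^esub> = (\<lambda>g\<in>carrier G. \<one>\<^bsub>M\<^esub>)"
  by (simp add: Z1_def)

lemma inv_Z: assumes "z \<in> carrier Z" shows "inv\<^bsub>Z\<^esub> z = (\<lambda>g\<in>carrier G. inv\<^bsub>M\<^esub> z g)"
proof -
  have "inv\<^bsub>Z\<^esub> z = inv\<^bsub>cochains\<^esub> z"
    using group.m_inv_consistent[OF comm_group.axioms(2)[OF comm_group_cochains] subgroup_Z assms]
    by (simp add: Z1_def)
  then show ?thesis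
    using assms by (simp add: inv_product_group carrier_Z M.is_group)
qed

definition coboundary :: "'m \<Rightarrow> 'g \<Rightarrow> 'm" where
  "coboundary m = (\<lambda>g\<in>carrier G. act g m \<otimes>\<^bsub>M\<^esub> inv\<^bsub>M\<^esub> m)"

lemma B_eq: "B = coboundary ` carrier M"
  by (simp add: B1_def coboundary_def)

lemma coboundary_closed: 
  assumes m: "m \<in> carrier M" shows "coboundary m \<in> carrier Z"
proof -
  have "act g (act h m) \<otimes>\<^bsub>M\<^esub> inv\<^bsub>M\<^esub> m
      = act g m \<otimes>\<^bsub>M\<^esub> inv\<^bsub>M\<^esub> m \<otimes>\<^bsub>M\<^esub> (act g (act h m) \<otimes>\<^bsub>M\<^esub> inv\<^bsub>M\<^esub> (act g m))"
    if "g \<in> carrier G" "h \<in> carrier G" for g h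
  proof -
    have "act g m \<otimes>\<^bsub>M\<^esub> inv\<^bsub>M\<^esub> m \<otimes>\<^bsub>M\<^esub> (act g (act h m) \<otimes>\<^bsub>M\<^esub> inv\<^bsub>M\<^esub> (act g m))
      = (act g m \<otimes>\<^bsub>M\<^esub> inv\<^bsub>M\<^esub> (act g m)) \<otimes>\<^bsub>M\<^esub> (act g (act h m) \<otimes>\<^bsub>M\<^esub> inv\<^bsub>M\<^esub> m)"
      using that m by (simp add: M.m_ac del: M.r_inv M.Units_r_inv)
    then show ?thesis using that m by simp
  qed
  with m show ?thesis
    by (intro cocycleI) (simp_all add: coboundary_def act_mult act_m act_inv)
qed

lemma coboundary_hom: "coboundary \<in> hom M Z"
proof (rule homI)
  show "coboundary (a \<otimes>\<^bsub>M\<^esub> b) = coboundary a \<otimes>\<^bsub>Z\<^esub> coboundary b"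
    if "a \<in> carrier M" "b \<in> carrier M" for a b
    using that by (simp add: coboundary_def mult_Z act_m M.inv_mult M.m_ac cong: restrict_cong)
qed (rule coboundary_closed)

lemma subgroup_B: "subgroup B Z"
  unfolding B_eq
  by (rule group_hom.img_is_subgroup)
     (simp add: group_hom_def group_hom_axioms_def coboundary_hom M.is_group Z.is_group)

sublocale H: comm_group "H1 G M act"
  unfolding H1_def by (rule Z.abelian_FactGroup[OF subgroup_B])

definition cls :: "('g \<Rightarrow> 'm) \<Rightarrow> ('g \<Rightarrow> 'm) set" where
  "cls z = B #>\<^bsub>Z\<^esub> z"

lemma cls_hom: "cls \<in> hom Z (H1 G M act)"
  unfolding cls_def[abs_def] H1_def
  by (rule normal.r_coset_hom_Mod[OF Z.subgroup_imp_normal[OF subgroup_B]])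

lemma carrier_H: "carrier (H1 G M act) = cls ` carrier Z"
  by (auto simp: H1_def carrier_FactGroup cls_def)

lemma mem_cls: "z \<in> carrier Z \<Longrightarrow> c \<in> cls z \<longleftrightarrow> (\<exists>m\<in>carrier M. c = coboundary m \<otimes>\<^bsub>Z\<^esub> z)"
  by (auto simp: cls_def r_coset_def B_eq)

lemma cls_eq_iff:
  assumes "y \<in> carrier Z" "z \<in> carrier Z"
  shows "cls y = cls z \<longleftrightarrow> (\<exists>m\<in>carrier M. y = coboundary m \<otimes>\<^bsub>Z\<^esub> z)"
proof -
  have "cls y = cls z \<longleftrightarrow> y \<in> cls z"
    unfolding cls_def
    using Z.repr_independence[OF _ assms(2) subgroup_B] Z.repr_independenceD[OF subgroup_B assms(1)]
      Z.rcos_self[OF assms(1) subgroup_B] by metis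
  then show ?thesis using mem_cls assms by simp
qed

end

text \<open>
  An equivariant homomorphism \<open>f\<close> induces \<open>push\<close> on cocycles. What matters later is the
  cokernel of the induced map on $H^1$, entered directly from cocycles by \<open>quot\<close>: a cocycle
  dies there iff it is a coboundary times a pushed cocycle, so that equality of classes in the
  cokernel can be decided on cocycles.
\<close>

locale g_module_hom = M: g_module G M act + N: g_module G N act'
  for G :: "('g, 'a) monoid_scheme" and M :: "'m monoid" and act and N :: "'n monoid" and act' +
  fixes f
  assumes f_hom: "f \<in> hom M N"
    and f_act: "\<lbrakk>g \<in> carrier G; m \<in> carrier M\<rbrakk> \<Longrightarrow> f (act g m) = act' g (f m)"
begin

sublocale f: group_hom M N f
  by unfold_locales (rule f_hom)

definition push :: "('g \<Rightarrow> 'm) \<Rightarrow> 'g \<Rightarrow> 'n" where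
  "push z = (\<lambda>g\<in>carrier G. f (z g))"

lemma push_closed: "z \<in> carrier M.Z \<Longrightarrow> push z \<in> carrier N.Z"
  by (rule N.cocycleI) (simp_all add: push_def M.cocycle_mult f_act)

lemma push_hom: "push \<in> hom M.Z N.Z"
  by (rule homI) (simp_all add: push_closed, simp add: push_def M.mult_Z N.mult_Z cong: restrict_cong)

lemma push_coboundary: "m \<in> carrier M \<Longrightarrow> push (M.coboundary m) = N.coboundary (f m)"
  by (simp add: push_def M.coboundary_def N.coboundary_def f_act cong: restrict_cong)

text \<open>
  The coset \<open>B #> z\<close> is mapped by \<open>push\<close> into, but in general not onto, the coset of
  \<open>push z\<close>, because only the coboundaries of elements in the image of \<open>f\<close> are hit. Multiplying by
  all coboundaries of the target fills up that coset.
\<close>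

lemma H1_map_cls:
  assumes z: "z \<in> carrier M.Z"
  shows "H1_map G N act' f (M.cls z) = N.cls (push z)"
proof -
  have pz: "push z \<in> carrier N.Z" using z by (rule push_closed)
  have "M.cls z = (\<lambda>m. M.coboundary m \<otimes>\<^bsub>M.Z\<^esub> z) ` carrier M"
    using M.mem_cls[OF z] by auto
  then have P: "push ` M.cls z = (\<lambda>m. N.coboundary (f m) \<otimes>\<^bsub>N.Z\<^esub> push z) ` carrier M"
    using hom_mult[OF push_hom M.coboundary_closed z]
    by (simp add: image_image push_coboundary cong: image_cong_simp)
  have "H1_map G N act' f (M.cls z) = N.B <#>\<^bsub>N.Z\<^esub> (push ` M.cls z)"
    by (simp add: H1_map_def push_def)
  also have "\<dots> = N.cls (push z)"
  proof (intro equalityI subsetI)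
    fix c assume "c \<in> N.B <#>\<^bsub>N.Z\<^esub> (push ` M.cls z)"
    then obtain m k where mk: "m \<in> carrier M" "k \<in> carrier N"
      "c = N.coboundary k \<otimes>\<^bsub>N.Z\<^esub> (N.coboundary (f m) \<otimes>\<^bsub>N.Z\<^esub> push z)"
      unfolding P by (auto simp: set_mult_def N.B_eq)
    then have "c = N.coboundary (k \<otimes>\<^bsub>N\<^esub> f m) \<otimes>\<^bsub>N.Z\<^esub> push z"
      using pz by (simp add: hom_mult[OF N.coboundary_hom] N.coboundary_closed N.Z.m_assoc)
    then show "c \<in> N.cls (push z)"
      using mk pz by (auto simp: N.mem_cls)
  next
    fix c assume "c \<in> N.cls (push z)"
    then obtain k where k: "k \<in> carrier N" "c = N.coboundary k \<otimes>\<^bsub>N.Z\<^esub> push z"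
      using pz by (auto simp: N.mem_cls)
    have "push z \<in> push ` M.cls z"
      using M.Z.rcos_self[OF z M.subgroup_B] by (auto simp: M.cls_def)
    then show "c \<in> N.B <#>\<^bsub>N.Z\<^esub> (push ` M.cls z)"
      using k unfolding set_mult_def N.B_eq by blast
  qed
  finally show ?thesis .
qed

abbreviation "Img \<equiv> H1_map G N act' f ` carrier (H1 G M act)"

lemma Img_eq: "Img = (\<lambda>z. N.cls (push z)) ` carrier M.Z"
  unfolding M.carrier_H image_image by (rule image_cong) (simp_all add: H1_map_cls)

abbreviation "coker \<equiv> H1 G N act' Mod Img"

lemma subgroup_Img: "subgroup Img (H1 G N act')"
proof -
  have "(\<lambda>z. N.cls (push z)) \<in> hom M.Z (H1 G N act')"
    using hom_compose[OF push_hom N.cls_hom] by (simp add: comp_def)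
  then show ?thesis
    unfolding Img_eq
    by (intro group_hom.img_is_subgroup)
       (simp add: group_hom_def group_hom_axioms_def M.Z.is_group N.H.is_group)
qed

definition quot :: "('g \<Rightarrow> 'n) \<Rightarrow> ('g \<Rightarrow> 'n) set set" where
  "quot c = Img #>\<^bsub>H1 G N act'\<^esub> N.cls c"

lemma comm_group_coker: "comm_group (coker)"
  by (rule N.H.abelian_FactGroup[OF subgroup_Img])

lemma quot_hom: "quot \<in> hom N.Z (coker)"
  using hom_compose[OF N.cls_hom normal.r_coset_hom_Mod[OF N.H.subgroup_imp_normal[OF subgroup_Img]]]
  by (simp add: quot_def[abs_def] comp_def)

sublocale quot: group_hom N.Z "coker" quot
  using quot_hom comm_group_coker
  by (simp add: group_hom_def group_hom_axioms_def N.Z.is_group comm_group.axioms(2))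

lemma quot_eq_one_iff:
  assumes c: "c \<in> carrier N.Z"
  shows "quot c = \<one>\<^bsub>coker\<^esub> \<longleftrightarrow>
    (\<exists>m\<in>carrier N. \<exists>z\<in>carrier M.Z. c = N.coboundary m \<otimes>\<^bsub>N.Z\<^esub> push z)"
proof -
  have cH: "N.cls c \<in> carrier (H1 G N act')" using c by (simp add: N.carrier_H)
  have "quot c = \<one>\<^bsub>coker\<^esub> \<longleftrightarrow> Img #>\<^bsub>H1 G N act'\<^esub> N.cls c = Img"
    by (simp add: quot_def)
  also have "\<dots> \<longleftrightarrow> N.cls c \<in> Img"
    using N.H.coset_join1[OF _ cH subgroup_Img] N.H.coset_join2[OF cH subgroup_Img]
      subgroup_Img by blast
  also have "\<dots> \<longleftrightarrow> (\<exists>z\<in>carrier M.Z. N.cls c = N.cls (push z))"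
    unfolding Img_eq by blast
  finally show ?thesis by (auto simp: N.cls_eq_iff[OF c push_closed])
qed

end

section \<open>Roots of unity and permutation modules\<close>

lemma mu_nonzero: "n \<ge> 1 \<Longrightarrow> z \<in> mu n \<Longrightarrow> z \<noteq> 0"
  by (auto simp: mu_def power_0_left)

lemma one_mem_mu [simp]: "1 \<in> mu n"
  by (simp add: mu_def)

lemma mu_mult [simp]: "y \<in> mu n \<Longrightarrow> z \<in> mu n \<Longrightarrow> y * z \<in> mu n"
  by (simp add: mu_def power_mult_distrib)

lemma mu_cnj [simp]: "z \<in> mu n \<Longrightarrow> cnj z \<in> mu n"
  by (simp add: mu_def flip: complex_cnj_power)

lemma norm_mu: "n \<ge> 1 \<Longrightarrow> z \<in> mu n \<Longrightarrow> cmod z = 1"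
  using power_eq_1_iff[of z n] by (auto simp: mu_def)

text \<open>
  The inverse of a root of unity is its conjugate. This turns the conjugate transposes in the
  matrix conditions into inverses in the modules.
\<close>

lemma mu_mult_cnj:
  assumes "n \<ge> 1" "z \<in> mu n"
  shows "z * cnj z = 1" "cnj z * z = 1"
  using norm_mu[OF assms] by (simp_all add: mult.commute flip: complex_norm_square)

lemma comm_group_mu:
  assumes "n \<ge> 1"
  shows "comm_group (mu_group n)"
proof -
  have "\<exists>y\<in>mu n. y * z = 1" if "z \<in> mu n" for z
    using mu_mult_cnj(2)[OF assms that] mu_cnj[OF that] by blast
  then show ?thesis
    by (intro comm_groupI) (auto simp: mu_group_def)
qed

lemma mu_group_simps [simp]:
  "carrier (mu_group n) = mu n" "x \<otimes>\<^bsub>mu_group n\<^esub> y = x * y" "\<one>\<^bsub>mu_group n\<^esub> = 1"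
  by (simp_all add: mu_group_def)

lemma inv_mu_group: "n \<ge> 1 \<Longrightarrow> z \<in> mu n \<Longrightarrow> inv\<^bsub>mu_group n\<^esub> z = cnj z"
  using group.inv_equality[OF comm_group.axioms(2)[OF comm_group_mu], of n "cnj z" z]
  by (simp add: mu_mult_cnj)

lemma comm_group_mu_perm: "n \<ge> 1 \<Longrightarrow> comm_group (mu_perm n S)"
  unfolding mu_perm_def by (intro comm_group_product_group comm_group_mu)

lemma mu_perm_simps [simp]:
  "carrier (mu_perm n S) = S \<rightarrow>\<^sub>E mu n"
  "v \<otimes>\<^bsub>mu_perm n S\<^esub> w = (\<lambda>s\<in>S. v s * w s)"
  "\<one>\<^bsub>mu_perm n S\<^esub> = (\<lambda>s\<in>S. 1)"
  by (simp_all add: mu_perm_def)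

lemma inv_mu_perm:
  assumes "n \<ge> 1" "v \<in> S \<rightarrow>\<^sub>E mu n"
  shows "inv\<^bsub>mu_perm n S\<^esub> v = (\<lambda>s\<in>S. cnj (v s))"
proof -
  have "inv\<^bsub>mu_perm n S\<^esub> v = (\<lambda>s\<in>S. inv\<^bsub>mu_group n\<^esub> (v s))"
    unfolding mu_perm_def using assms
    by (intro inv_product_group) (auto simp: comm_group.axioms(2)[OF comm_group_mu])
  also have "\<dots> = (\<lambda>s\<in>S. cnj (v s))"
    using assms by (intro restrict_ext inv_mu_group) auto
  finally show ?thesis .
qed

text \<open>
  The underlying maps are constrained only on \<open>S\<close>. Unlike \<^locale>\<open>group_action\<close>, which asks for
  extensional bijections, this also covers the diagonal action on a stable subset of a product.
\<close>

locale g_set = group G for G (structure) +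
  fixes S :: "'s set" and \<phi>
  assumes closed [simp]: "g \<in> carrier G \<Longrightarrow> s \<in> S \<Longrightarrow> \<phi> g s \<in> S"
    and mult: "\<lbrakk>g \<in> carrier G; h \<in> carrier G; s \<in> S\<rbrakk> \<Longrightarrow> \<phi> (g \<otimes> h) s = \<phi> g (\<phi> h s)"
    and one: "s \<in> S \<Longrightarrow> \<phi> \<one> s = s"
begin

lemma inv_left [simp]: "g \<in> carrier G \<Longrightarrow> s \<in> S \<Longrightarrow> \<phi> (inv g) (\<phi> g s) = s"
  by (simp add: one flip: mult)

lemma inv_right [simp]: "g \<in> carrier G \<Longrightarrow> s \<in> S \<Longrightarrow> \<phi> g (\<phi> (inv g) s) = s"
  by (simp add: one flip: mult)

lemma eq_iff: "\<lbrakk>g \<in> carrier G; s \<in> S; t \<in> S\<rbrakk> \<Longrightarrow> s = \<phi> g t \<longleftrightarrow> t = \<phi> (inv g) s"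
  by auto

lemma inv_mult_act:
  "\<lbrakk>g \<in> carrier G; h \<in> carrier G; s \<in> S\<rbrakk> \<Longrightarrow> \<phi> (inv (g \<otimes> h)) s = \<phi> (inv h) (\<phi> (inv g) s)"
  by (simp add: inv_mult_group mult)

lemma g_module_mu_perm:
  assumes "n \<ge> 1"
  shows "g_module G (mu_perm n S) (perm_act G S \<phi>)"
proof (intro g_module.intro g_module_axioms.intro comm_group_mu_perm is_group assms)
  show "perm_act G S \<phi> g \<in> hom (mu_perm n S) (mu_perm n S)" if "g \<in> carrier G" for g
    using that by (intro homI) (auto simp: perm_act_def)
  show "perm_act G S \<phi> (g \<otimes> h) m = perm_act G S \<phi> g (perm_act G S \<phi> h m)"
    if "g \<in> carrier G" "h \<in> carrier G" "m \<in> carrier (mu_perm n S)" for g h m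
    using that by (simp add: perm_act_def inv_mult_act cong: restrict_cong)
qed

end

lemma g_set_of_group_action:
  assumes "group_action G E \<phi>"
  shows "g_set G E \<phi>"
proof -
  interpret group_action G E \<phi> by fact
  interpret group_hom G "BijGroup E" \<phi> by (rule group_hom)
  show ?thesis
  proof
    show "\<phi> g s \<in> E" if "g \<in> carrier G" "s \<in> E" for g s
      using that element_image by blast
    show "\<phi> (g \<otimes>\<^bsub>G\<^esub> h) s = \<phi> g (\<phi> h s)" if "g \<in> carrier G" "h \<in> carrier G" "s \<in> E" for g h s
      using that(3,1,2) by (rule composition_rule)
    show "\<phi> \<one>\<^bsub>G\<^esub> s = s" if "s \<in> E" for s
      using that by (simp add: BijGroup_def)
  qed
qed

lemma g_set_pair:
  assumes "g_set G X \<phi>" "g_set G Y \<psi>" "\<O> \<subseteq> X \<times> Y" "G_stable G \<phi> \<psi> \<O>"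
  shows "g_set G \<O> (pair_act \<phi> \<psi>)"
proof -
  interpret X: g_set G X \<phi> by fact
  interpret Y: g_set G Y \<psi> by fact
  show ?thesis
    using assms(3,4)
    by unfold_locales (auto simp: pair_act_def G_stable_def X.mult Y.mult X.one Y.one)
qed

lemma g_module_trivial:
  assumes "Group.group G" "comm_group M"
  shows "g_module G M trivial_act"
  using assms by (auto simp: g_module_def g_module_axioms_def trivial_act_def hom_def)

lemma g_module_DirProd:
  assumes "g_module G M act" "g_module G N act'"
  shows "g_module G (M \<times>\<times> N) (\<lambda>g. map_prod (act g) (act' g))"
proof -
  interpret M: g_module G M act by fact
  interpret N: g_module G N act' by fact
  show ?thesis
  proof (intro g_module.intro g_module_axioms.intro comm_group_DirProd
      M.M.comm_group_axioms N.M.comm_group_axioms M.G.is_group)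
    show "map_prod (act g) (act' g) \<in> hom (M \<times>\<times> N) (M \<times>\<times> N)" if "g \<in> carrier G" for g
      using that by (intro homI) (auto simp: M.act_m N.act_m)
    show "map_prod (act (g \<otimes>\<^bsub>G\<^esub> h)) (act' (g \<otimes>\<^bsub>G\<^esub> h)) m
        = map_prod (act g) (act' g) (map_prod (act h) (act' h) m)"
      if "g \<in> carrier G" "h \<in> carrier G" "m \<in> carrier (M \<times>\<times> N)" for g h m
      using that by (auto simp: M.act_mult N.act_mult)
  qed
qed

section \<open>A pair of finite sets with a stable irreducible subset\<close>

locale g_set_pair = X: g_set G X \<phi> + Y: g_set G Y \<psi>
  for G :: "('g, 'a) monoid_scheme" and X :: "'x set" and \<phi> and Y :: "'y set" and \<psi> +
  fixes n :: nat and \<O> :: "('x \<times> 'y) set"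
  assumes finite_X: "finite X" and finite_Y: "finite Y" and n: "n \<ge> 1"
    and stable: "G_stable G \<phi> \<psi> \<O>" and irreducible: "irreducible_subset X Y \<O>"
begin

lemma O_subset: "\<O> \<subseteq> X \<times> Y"
  using irreducible by (simp add: irreducible_subset_def)

sublocale O: g_set G \<O> "pair_act \<phi> \<psi>"
  by (rule g_set_pair[OF X.g_set_axioms Y.g_set_axioms O_subset stable])

lemma vertex_exists: "X \<noteq> {} \<or> Y \<noteq> {}"
  using irreducible by (auto simp: irreducible_subset_def connected_conv bipartite_graph_def)

text \<open>
  The common function \<open>case_sum u v\<close> on the vertices does not change along an edge, so it is
  constant on the connected graph. One of \<open>X\<close> and \<open>Y\<close> may be empty (then the other is a single
  point and \<open>\<O>\<close> is empty), which is why the constant is not taken from an element of \<open>\<O>\<close>.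
\<close>

lemma irreducible_constant:
  assumes "\<And>x y. (x, y) \<in> \<O> \<Longrightarrow> u x = v y"
  shows "\<exists>\<zeta>. (\<forall>x\<in>X. u x = \<zeta>) \<and> (\<forall>y\<in>Y. v y = \<zeta>)"
proof -
  let ?B = "with_proj (bipartite_graph X Y \<O>)"
  let ?w = "case_sum u v"
  have conn: "Digraph_Component.connected ?B"
    using irreducible by (simp add: irreducible_subset_def)
  have path: "?w b = ?w a" if "(a, b) \<in> rtrancl_on (verts ?B) ((arcs_ends ?B)\<^sup>s)" for a b
    using that
    by (induction rule: rtrancl_on_induct)
       (auto simp: symcl_def bipartite_graph_def assms)
  have const: "?w b = ?w a" if "a \<in> X <+> Y" "b \<in> X <+> Y" for a b
    using conn path that by (auto simp: connected_conv bipartite_graph_def)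
  obtain a where a: "a \<in> X <+> Y"
    using vertex_exists by blast
  show ?thesis
    using const[OF a InlI] const[OF a InrI] by (intro exI[of _ "?w a"]) simp
qed

sublocale mu: g_module G "mu_group n" trivial_act
  by (intro g_module_trivial X.is_group comm_group_mu n)

sublocale D: g_module G "mu_sum n X Y" "sum_act G X \<phi> Y \<psi>"
proof -
  have "sum_act G X \<phi> Y \<psi> = (\<lambda>g. map_prod (perm_act G X \<phi> g) (perm_act G Y \<psi> g))"
    by (simp add: fun_eq_iff sum_act_def)
  then show "g_module G (mu_sum n X Y) (sum_act G X \<phi> Y \<psi>)"
    using g_module_DirProd[OF X.g_module_mu_perm[OF n] Y.g_module_mu_perm[OF n]]
    by (simp add: mu_sum_def)
qed

lemma mu_sum_simps [simp]:
  "carrier (mu_sum n X Y) = (X \<rightarrow>\<^sub>E mu n) \<times> (Y \<rightarrow>\<^sub>E mu n)"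
  "m \<otimes>\<^bsub>mu_sum n X Y\<^esub> m' = (\<lambda>x\<in>X. fst m x * fst m' x, \<lambda>y\<in>Y. snd m y * snd m' y)"
  "\<one>\<^bsub>mu_sum n X Y\<^esub> = (\<lambda>x\<in>X. 1, \<lambda>y\<in>Y. 1)"
  by (simp_all add: mu_sum_def DirProd_def case_prod_beta)

lemma inv_mu_sum:
  assumes "m \<in> carrier (mu_sum n X Y)"
  shows "inv\<^bsub>mu_sum n X Y\<^esub> m = (\<lambda>x\<in>X. cnj (fst m x), \<lambda>y\<in>Y. cnj (snd m y))"
proof -
  obtain p q where m: "m = (p, q)" "p \<in> X \<rightarrow>\<^sub>E mu n" "q \<in> Y \<rightarrow>\<^sub>E mu n"
    using assms by auto
  show ?thesis
    using m n
    by (simp add: mu_sum_def inv_DirProd inv_mu_perm comm_group.axioms(2)[OF comm_group_mu_perm])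
qed

sublocale Delta: g_module_hom G "mu_group n" trivial_act "mu_sum n X Y" "sum_act G X \<phi> Y \<psi>" "Delta X Y"
proof
  show "Delta X Y \<in> hom (mu_group n) (mu_sum n X Y)"
    by (rule homI) (auto simp: Delta_def)
  show "Delta X Y (trivial_act g m) = sum_act G X \<phi> Y \<psi> g (Delta X Y m)"
    if "g \<in> carrier G" "m \<in> carrier (mu_group n)" for g m
    using that by (auto simp: Delta_def trivial_act_def sum_act_def perm_act_def)
qed

lemma cocycle_closed [simp]:
  assumes "c \<in> carrier D.Z" "g \<in> carrier G"
  shows "x \<in> X \<Longrightarrow> fst (c g) x \<in> mu n" "y \<in> Y \<Longrightarrow> snd (c g) y \<in> mu n"
  using D.cocycle_closed[OF assms] by (auto simp: mem_Times_iff)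

lemma cocycle_mult:
  assumes "c \<in> carrier D.Z" "g \<in> carrier G" "h \<in> carrier G"
  shows "x \<in> X \<Longrightarrow> fst (c (g \<otimes>\<^bsub>G\<^esub> h)) x = fst (c g) x * fst (c h) (\<phi> (inv\<^bsub>G\<^esub> g) x)"
    and "y \<in> Y \<Longrightarrow> snd (c (g \<otimes>\<^bsub>G\<^esub> h)) y = snd (c g) y * snd (c h) (\<psi> (inv\<^bsub>G\<^esub> g) y)"
  using D.cocycle_mult[OF assms] assms by (simp_all add: sum_act_def perm_act_def)

lemma D_cocycleI:
  assumes ext: "c \<in> extensional (carrier G)"
    and fst: "\<And>g. g \<in> carrier G \<Longrightarrow> fst (c g) \<in> X \<rightarrow>\<^sub>E mu n"
    and snd: "\<And>g. g \<in> carrier G \<Longrightarrow> snd (c g) \<in> Y \<rightarrow>\<^sub>E mu n"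
    and fst_mult: "\<And>g h x. \<lbrakk>g \<in> carrier G; h \<in> carrier G; x \<in> X\<rbrakk> \<Longrightarrow>
       fst (c (g \<otimes>\<^bsub>G\<^esub> h)) x = fst (c g) x * fst (c h) (\<phi> (inv\<^bsub>G\<^esub> g) x)"
    and snd_mult: "\<And>g h y. \<lbrakk>g \<in> carrier G; h \<in> carrier G; y \<in> Y\<rbrakk> \<Longrightarrow>
       snd (c (g \<otimes>\<^bsub>G\<^esub> h)) y = snd (c g) y * snd (c h) (\<psi> (inv\<^bsub>G\<^esub> g) y)"
  shows "c \<in> carrier D.Z"
proof (rule D.cocycleI[OF ext])
  show "c g \<in> carrier (mu_sum n X Y)" if "g \<in> carrier G" for g
    using fst[OF that] snd[OF that] by (simp add: mem_Times_iff)
  show "c (g \<otimes>\<^bsub>G\<^esub> h) = c g \<otimes>\<^bsub>mu_sum n X Y\<^esub> sum_act G X \<phi> Y \<psi> g (c h)"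
    if g: "g \<in> carrier G" and h: "h \<in> carrier G" for g h
  proof (rule prod_eqI)
    have gh: "g \<otimes>\<^bsub>G\<^esub> h \<in> carrier G" using g h by simp
    show "fst (c (g \<otimes>\<^bsub>G\<^esub> h)) = fst (c g \<otimes>\<^bsub>mu_sum n X Y\<^esub> sum_act G X \<phi> Y \<psi> g (c h))"
      using fst[OF gh] g h
      by (intro extensionalityI[of _ X]) (auto simp: PiE_iff sum_act_def perm_act_def fst_mult)
    show "snd (c (g \<otimes>\<^bsub>G\<^esub> h)) = snd (c g \<otimes>\<^bsub>mu_sum n X Y\<^esub> sum_act G X \<phi> Y \<psi> g (c h))"
      using snd[OF gh] g h
      by (intro extensionalityI[of _ Y]) (auto simp: PiE_iff sum_act_def perm_act_def snd_mult)
  qed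
qed

lemma coboundary_entries:
  assumes "m \<in> carrier (mu_sum n X Y)" "g \<in> carrier G"
  shows "x \<in> X \<Longrightarrow> fst (D.coboundary m g) x = fst m (\<phi> (inv\<^bsub>G\<^esub> g) x) * cnj (fst m x)"
    and "y \<in> Y \<Longrightarrow> snd (D.coboundary m g) y = snd m (\<psi> (inv\<^bsub>G\<^esub> g) y) * cnj (snd m y)"
  using assms by (simp_all add: D.coboundary_def sum_act_def perm_act_def inv_mu_sum del: mu_sum_simps(1))

lemma cocycle_entries:
  assumes "g \<in> carrier G"
  shows "x \<in> X \<Longrightarrow> fst ((c \<otimes>\<^bsub>D.Z\<^esub> d) g) x = fst (c g) x * fst (d g) x"
    and "y \<in> Y \<Longrightarrow> snd ((c \<otimes>\<^bsub>D.Z\<^esub> d) g) y = snd (c g) y * snd (d g) y"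
  using assms by (simp_all add: D.mult_Z)

lemma push_entries:
  assumes "g \<in> carrier G"
  shows "x \<in> X \<Longrightarrow> fst (Delta.push z g) x = z g"
    and "y \<in> Y \<Longrightarrow> snd (Delta.push z g) y = z g"
  using assms by (simp_all add: Delta.push_def Delta_def)

end

section \<open>Diagonal and monomial matrices by entries\<close>

lemma mmult_diag_left:
  assumes "finite S"
  shows "mmult S (diag_matrix S u) B = (\<lambda>s t. if s \<in> S then u s * B s t else 0)"
proof (intro ext)
  fix s t
  have "(\<Sum>r\<in>S. (if s \<in> S \<and> s = r then u s else 0) * B r t)
      = (\<Sum>r\<in>S. if s = r then (if s \<in> S then u s * B s t else 0) else 0)"
    by (rule sum.cong) auto
  then show "mmult S (diag_matrix S u) B s t = (if s \<in> S then u s * B s t else 0)"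
    using assms by (simp add: mmult_def diag_matrix_def)
qed

lemma mmult_diag_right:
  assumes "finite S"
  shows "mmult S B (ctranspose (diag_matrix S v)) = (\<lambda>s t. if t \<in> S then B s t * cnj (v t) else 0)"
proof (intro ext)
  fix s t
  have "(\<Sum>r\<in>S. B s r * cnj (if t \<in> S \<and> t = r then v t else 0))
      = (\<Sum>r\<in>S. if t = r then (if t \<in> S then B s t * cnj (v t) else 0) else 0)"
    by (rule sum.cong) auto
  then show "mmult S B (ctranspose (diag_matrix S v)) s t = (if t \<in> S then B s t * cnj (v t) else 0)"
    using assms by (simp add: mmult_def ctranspose_def diag_matrix_def)
qed

lemma D_equiv_iff:
  assumes "finite X" "finite Y"
  shows "D_equiv n X Y A B \<longleftrightarrow> (\<exists>u\<in>X \<rightarrow> mu n. \<exists>v\<in>Y \<rightarrow> mu n.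
    A = (\<lambda>x y. if x \<in> X \<and> y \<in> Y then u x * B x y * cnj (v y) else 0))"
proof -
  have "mmult Y (mmult X (diag_matrix X u) B) (ctranspose (diag_matrix Y v))
      = (\<lambda>x y. if x \<in> X \<and> y \<in> Y then u x * B x y * cnj (v y) else 0)" for u v
    unfolding mmult_diag_right[OF assms(2)] mmult_diag_left[OF assms(1)] by (auto simp: fun_eq_iff)
  moreover have "D_equiv n X Y A B \<longleftrightarrow> (\<exists>u\<in>X \<rightarrow> mu n. \<exists>v\<in>Y \<rightarrow> mu n.
      A = mmult Y (mmult X (diag_matrix X u) B) (ctranspose (diag_matrix Y v)))"
    unfolding D_equiv_def diag_group_def by blast
  ultimately show ?thesis by simp
qed

context g_set
begin

text \<open>
  If \<open>u\<close> takes values in the roots of unity, this is the general monomial matrix whose entrywise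
  absolute value is the permutation matrix of \<open>g\<close>; the nonzero entry in row \<open>s\<close> is \<open>u s\<close>, and it
  stands in column \<open>\<phi> (inv g) s\<close>. Both components of a monomial cover have this form.
\<close>

definition signed_perm :: "('s \<Rightarrow> complex) \<Rightarrow> 'a \<Rightarrow> 's \<Rightarrow> 's \<Rightarrow> complex" where
  "signed_perm u g = mmult S (diag_matrix S u) (perm_matrix S \<phi> g)"

lemma signed_perm_entry:
  assumes "finite S"
  shows "signed_perm u g s t = (if s \<in> S \<and> t \<in> S \<and> s = \<phi> g t then u s else 0)"
  unfolding signed_perm_def mmult_diag_left[OF assms] by (auto simp: perm_matrix_def)

lemma signed_perm_left:
  assumes "finite S" "g \<in> carrier G"
  shows "mmult S (signed_perm u g) A = (\<lambda>s y. if s \<in> S then u s * A (\<phi> (inv g) s) y else 0)"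
proof (intro ext)
  fix s y
  have "(\<Sum>t\<in>S. signed_perm u g s t * A t y)
      = (\<Sum>t\<in>S. if t = \<phi> (inv g) s then (if s \<in> S then u s * A t y else 0) else 0)"
    using assms by (intro sum.cong) (auto simp: signed_perm_entry)
  then show "mmult S (signed_perm u g) A s y = (if s \<in> S then u s * A (\<phi> (inv g) s) y else 0)"
    using assms by (simp add: mmult_def)
qed

lemma signed_perm_right:
  assumes "finite S" "g \<in> carrier G"
  shows "mmult S A (ctranspose (signed_perm u g))
    = (\<lambda>x s. if s \<in> S then A x (\<phi> (inv g) s) * cnj (u s) else 0)"
proof (intro ext)
  fix x s
  have "(\<Sum>t\<in>S. A x t * cnj (signed_perm u g s t))
      = (\<Sum>t\<in>S. if t = \<phi> (inv g) s then (if s \<in> S then A x t * cnj (u s) else 0) else 0)"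
    using assms by (intro sum.cong) (auto simp: signed_perm_entry)
  then show "mmult S A (ctranspose (signed_perm u g)) x s
      = (if s \<in> S then A x (\<phi> (inv g) s) * cnj (u s) else 0)"
    using assms by (simp add: mmult_def ctranspose_def)
qed

text \<open>
  The product of the sign functions is twisted by the action of \<open>g\<close>, exactly as in the cocycle
  identity. Hence multiplicativity of a family of such matrices is the same as their signs forming
  a cocycle.
\<close>

lemma signed_perm_mult:
  assumes "finite S" "g \<in> carrier G" "h \<in> carrier G"
  shows "mmult S (signed_perm u g) (signed_perm v h)
    = signed_perm (\<lambda>s. u s * v (\<phi> (inv g) s)) (g \<otimes> h)"
proof (intro ext)
  fix s t
  have "\<phi> (inv g) s = \<phi> h t \<longleftrightarrow> s = \<phi> (g \<otimes> h) t" if "s \<in> S" "t \<in> S"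
    using that assms eq_iff[of g s "\<phi> h t"] by (auto simp: mult)
  then show "mmult S (signed_perm u g) (signed_perm v h) s t
      = signed_perm (\<lambda>s. u s * v (\<phi> (inv g) s)) (g \<otimes> h) s t"
    using assms by (auto simp: signed_perm_left signed_perm_entry)
qed

lemma signed_perm_eqD:
  assumes "finite S" "g \<in> carrier G" "signed_perm u g = signed_perm v g" "s \<in> S"
  shows "u s = v s"
proof -
  have "signed_perm w g s (\<phi> (inv g) s) = w s" for w
    using assms(1,2,4) by (simp add: signed_perm_entry)
  then show ?thesis using assms(3) by metis
qed

lemma signed_perm_Mon:
  assumes "finite S" "n \<ge> 1" "g \<in> carrier G" "\<And>s. s \<in> S \<Longrightarrow> u s \<in> mu n"
  shows "signed_perm u g \<in> carrier (Mon n S)"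
proof -
  have nz: "u s \<noteq> 0" if "s \<in> S" for s
    using assms that mu_nonzero by blast
  have "\<exists>!t. t \<in> S \<and> signed_perm u g s t \<noteq> 0" if "s \<in> S" for s
    using that assms nz by (intro ex1I[of _ "\<phi> (inv g) s"]) (auto simp: signed_perm_entry split: if_splits)
  moreover have "\<exists>!s. s \<in> S \<and> signed_perm u g s t \<noteq> 0" if "t \<in> S" for t
    using that assms nz by (intro ex1I[of _ "\<phi> g t"]) (auto simp: signed_perm_entry split: if_splits)
  ultimately show ?thesis
    using assms by (auto simp: Mon_def mu_matrices_def mu_plus_def signed_perm_entry)
qed

lemma entry_abs_signed_perm:
  assumes "finite S" "n \<ge> 1" "\<And>s. s \<in> S \<Longrightarrow> u s \<in> mu n"
  shows "entry_abs (signed_perm u g) = perm_matrix S \<phi> g"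
  using assms norm_mu[OF assms(2)]
  by (auto simp: fun_eq_iff entry_abs_def perm_matrix_def signed_perm_entry)

lemma signed_permI:
  assumes "finite S" "n \<ge> 1" "g \<in> carrier G" "P \<in> mu_matrices n S S"
    and abs: "entry_abs P = perm_matrix S \<phi> g"
  shows "P = signed_perm (\<lambda>s\<in>S. P s (\<phi> (inv g) s)) g" (is ?eq)
    and "(\<lambda>s\<in>S. P s (\<phi> (inv g) s)) \<in> S \<rightarrow>\<^sub>E mu n"
proof -
  have P: "complex_of_real (cmod (P s t)) = (if s \<in> S \<and> t \<in> S \<and> s = \<phi> g t then 1 else 0)" for s t
    using fun_cong[OF fun_cong[OF abs]] by (simp add: entry_abs_def perm_matrix_def)
  have zero: "P s t = 0" if "\<not> (s \<in> S \<and> t \<in> S \<and> s = \<phi> g t)" for s t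
    using P[of s t] that by simp
  show ?eq
    using assms(1,3) zero by (intro ext) (auto simp: signed_perm_entry)
  have "P s (\<phi> (inv g) s) \<in> mu n" if "s \<in> S" for s
  proof -
    have "P s (\<phi> (inv g) s) \<noteq> 0"
      using P[of s "\<phi> (inv g) s"] that assms(3) by auto
    moreover have "P s (\<phi> (inv g) s) \<in> mu_plus n"
      using assms(3,4) that by (simp add: mu_matrices_def)
    ultimately show ?thesis by (simp add: mu_plus_def)
  qed
  then show "(\<lambda>s\<in>S. P s (\<phi> (inv g) s)) \<in> S \<rightarrow>\<^sub>E mu n" by auto
qed

lemma row_sign_signed_perm:
  assumes "finite S" "g \<in> carrier G" "s \<in> S" "u s \<noteq> 0"
  shows "row_sign s (signed_perm u g) = u s"
  unfolding row_sign_def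
proof (rule the_equality)
  have "signed_perm u g s (\<phi> (inv g) s) = u s"
    using assms by (simp add: signed_perm_entry)
  then show "u s \<noteq> 0 \<and> (\<exists>t. signed_perm u g s t = u s)"
    using assms by blast
qed (use assms in \<open>auto simp: signed_perm_entry split: if_splits\<close>)

lemma orbit_act:
  assumes "g \<in> carrier G" "s \<in> S"
  shows "orbit G \<phi> (\<phi> g s) = orbit G \<phi> s"
proof (intro equalityI subsetI)
  fix t assume "t \<in> orbit G \<phi> (\<phi> g s)"
  then obtain h where "h \<in> carrier G" "t = \<phi> h (\<phi> g s)" by (auto simp: orbit_def)
  then have "t = \<phi> (h \<otimes> g) s" "h \<otimes> g \<in> carrier G" using assms by (simp_all add: mult)
  then show "t \<in> orbit G \<phi> s" by (auto simp: orbit_def)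
next
  fix t assume "t \<in> orbit G \<phi> s"
  then obtain h where "h \<in> carrier G" "t = \<phi> h s" by (auto simp: orbit_def)
  then have "t = \<phi> (h \<otimes> inv g) (\<phi> g s)" "h \<otimes> inv g \<in> carrier G" using assms by (simp_all add: mult)
  then show "t \<in> orbit G \<phi> (\<phi> g s)" by (auto simp: orbit_def)
qed

text \<open>
  A section of the orbit map together with transporters: \<open>r\<close> picks a representative that is the
  same along each orbit, and \<open>t s\<close> carries it to \<open>s\<close>.
\<close>

lemma orbit_representatives:
  obtains r t where "\<And>s. s \<in> S \<Longrightarrow> r s \<in> S" "\<And>s. s \<in> S \<Longrightarrow> t s \<in> carrier G"
    "\<And>s. s \<in> S \<Longrightarrow> \<phi> (t s) (r s) = s"
    "\<And>g s. g \<in> carrier G \<Longrightarrow> s \<in> S \<Longrightarrow> r (\<phi> g s) = r s"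
proof -
  define r where "r s = (SOME q. q \<in> orbit G \<phi> s)" for s
  have "\<exists>t\<in>carrier G. r s \<in> S \<and> \<phi> t (r s) = s" if s: "s \<in> S" for s
  proof -
    have "s \<in> orbit G \<phi> s" using one[OF s] by (force simp: orbit_def)
    then have "r s \<in> orbit G \<phi> s" unfolding r_def by (rule someI)
    then obtain g where g: "g \<in> carrier G" "r s = \<phi> g s" by (auto simp: orbit_def)
    then have "inv g \<in> carrier G" "r s \<in> S \<and> \<phi> (inv g) (r s) = s" using s by simp_all
    then show ?thesis by blast
  qed
  then obtain t where "\<And>s. s \<in> S \<Longrightarrow> t s \<in> carrier G \<and> r s \<in> S \<and> \<phi> (t s) (r s) = s"
    by metis
  moreover have "r (\<phi> g s) = r s" if "g \<in> carrier G" "s \<in> S" for g s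
    using orbit_act[OF that] by (simp add: r_def)
  ultimately show thesis using that by blast
qed

end

section \<open>Matrices twisted by a cocycle\<close>

context g_set_pair
begin

lemma inv_mem_O_iff:
  assumes "g \<in> carrier G" "x \<in> X" "y \<in> Y"
  shows "(\<phi> (inv\<^bsub>G\<^esub> g) x, \<psi> (inv\<^bsub>G\<^esub> g) y) \<in> \<O> \<longleftrightarrow> (x, y) \<in> \<O>"
  using assms O.closed[of g "(\<phi> (inv\<^bsub>G\<^esub> g) x, \<psi> (inv\<^bsub>G\<^esub> g) y)"] O.closed[of "inv\<^bsub>G\<^esub> g" "(x, y)"]
  by (auto simp: pair_act_def)

text \<open>
  The group of all matrices with support \<open>\<O>\<close>, in which $\mathbf h^0$ and $\mathbf h^1$ are subgroups.
\<close>

definition supported :: "('x \<Rightarrow> 'y \<Rightarrow> complex) monoid" where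
  "supported = \<lparr>carrier = {A \<in> mu_matrices n X Y. supp A = \<O>},
     monoid.mult = (\<lambda>A B x y. A x y * B x y), one = (\<lambda>x y. of_bool ((x, y) \<in> \<O>))\<rparr>"

lemma carrier_supported:
  "A \<in> carrier supported \<longleftrightarrow> (\<forall>x y. if (x, y) \<in> \<O> then A x y \<in> mu n else A x y = 0)"
  using O_subset mu_nonzero[OF n]
  by (auto simp: supported_def mu_matrices_def mu_plus_def supp_def set_eq_iff subset_iff)
     (metis insertE)+

lemma supported_entry: "A \<in> carrier supported \<Longrightarrow> (x, y) \<in> \<O> \<Longrightarrow> A x y \<in> mu n"
  and supported_zero: "A \<in> carrier supported \<Longrightarrow> (x, y) \<notin> \<O> \<Longrightarrow> A x y = 0"
  by (auto simp: carrier_supported split: if_splits)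

lemma supported_outside:
  "A \<in> carrier supported \<Longrightarrow> \<not> (x \<in> X \<and> y \<in> Y) \<Longrightarrow> A x y = 0"
  using supported_zero O_subset by blast

lemma mult_supported: "A \<otimes>\<^bsub>supported\<^esub> B = (\<lambda>x y. A x y * B x y)"
  and one_supported: "\<one>\<^bsub>supported\<^esub> = (\<lambda>x y. of_bool ((x, y) \<in> \<O>))"
  by (simp_all add: supported_def)

lemma supported_cnj:
  assumes "A \<in> carrier supported"
  shows "(\<lambda>x y. cnj (A x y)) \<in> carrier supported"
    and "(\<lambda>x y. cnj (A x y)) \<otimes>\<^bsub>supported\<^esub> A = \<one>\<^bsub>supported\<^esub>"
proof -
  show "(\<lambda>x y. cnj (A x y)) \<in> carrier supported"
    using assms by (auto simp: carrier_supported)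
  have "cnj (A x y) * A x y = of_bool ((x, y) \<in> \<O>)" for x y
    using supported_entry[OF assms] supported_zero[OF assms] n
    by (cases "(x, y) \<in> \<O>") (auto simp: mu_mult_cnj)
  then show "(\<lambda>x y. cnj (A x y)) \<otimes>\<^bsub>supported\<^esub> A = \<one>\<^bsub>supported\<^esub>"
    by (simp add: mult_supported one_supported)
qed

sublocale supported: comm_group supported
proof (rule comm_groupI)
  show "A \<otimes>\<^bsub>supported\<^esub> B \<in> carrier supported"
    if "A \<in> carrier supported" "B \<in> carrier supported" for A B
    using that by (simp add: carrier_supported mult_supported)
  show "\<one>\<^bsub>supported\<^esub> \<in> carrier supported"
    by (simp add: carrier_supported one_supported)
  show "\<one>\<^bsub>supported\<^esub> \<otimes>\<^bsub>supported\<^esub> A = A" if "A \<in> carrier supported" for A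
    using supported_zero[OF that] by (auto simp: mult_supported one_supported fun_eq_iff)
  show "\<exists>B\<in>carrier supported. B \<otimes>\<^bsub>supported\<^esub> A = \<one>\<^bsub>supported\<^esub>"
    if "A \<in> carrier supported" for A
    using supported_cnj[OF that] by blast
qed (simp_all add: mult_supported mult_ac)

lemma inv_supported:
  "A \<in> carrier supported \<Longrightarrow> inv\<^bsub>supported\<^esub> A = (\<lambda>x y. cnj (A x y))"
  using supported.inv_equality[OF supported_cnj(2) _ supported_cnj(1)] by simp

text \<open>
  \<open>A\<close> is fixed by the monomial cover of the cocycle \<open>c\<close>; see \<open>cover_fixes_iff_twisted\<close>.
\<close>

definition twisted where
  "twisted c A \<longleftrightarrow> (\<forall>g\<in>carrier G. \<forall>x\<in>X. \<forall>y\<in>Y.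
     A x y = fst (c g) x * A (\<phi> (inv\<^bsub>G\<^esub> g) x) (\<psi> (inv\<^bsub>G\<^esub> g) y) * cnj (snd (c g) y))"

lemma twistedD:
  "\<lbrakk>twisted c A; g \<in> carrier G; x \<in> X; y \<in> Y\<rbrakk> \<Longrightarrow>
     A x y = fst (c g) x * A (\<phi> (inv\<^bsub>G\<^esub> g) x) (\<psi> (inv\<^bsub>G\<^esub> g) y) * cnj (snd (c g) y)"
  by (simp add: twisted_def)

lemma twisted_mult:
  assumes "twisted c A" "twisted d B"
  shows "twisted (c \<otimes>\<^bsub>D.Z\<^esub> d) (A \<otimes>\<^bsub>supported\<^esub> B)"
  unfolding twisted_def
proof (intro ballI)
  fix g x y assume *: "g \<in> carrier G" "x \<in> X" "y \<in> Y"
  show "(A \<otimes>\<^bsub>supported\<^esub> B) x y = fst ((c \<otimes>\<^bsub>D.Z\<^esub> d) g) x *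
      (A \<otimes>\<^bsub>supported\<^esub> B) (\<phi> (inv\<^bsub>G\<^esub> g) x) (\<psi> (inv\<^bsub>G\<^esub> g) y) * cnj (snd ((c \<otimes>\<^bsub>D.Z\<^esub> d) g) y)"
    unfolding mult_supported cocycle_entries(1)[OF *(1,2)] cocycle_entries(2)[OF *(1,3)]
      twistedD[OF assms(1) *] twistedD[OF assms(2) *]
    by (simp add: mult_ac)
qed

lemma inv_cocycle_entries:
  assumes "c \<in> carrier D.Z" "g \<in> carrier G"
  shows "x \<in> X \<Longrightarrow> fst ((inv\<^bsub>D.Z\<^esub> c) g) x = cnj (fst (c g) x)"
    and "y \<in> Y \<Longrightarrow> snd ((inv\<^bsub>D.Z\<^esub> c) g) y = cnj (snd (c g) y)"
  using assms by (simp_all add: D.inv_Z inv_mu_sum del: mu_sum_simps)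

lemma twisted_inv:
  assumes "twisted c A" "c \<in> carrier D.Z" "A \<in> carrier supported"
  shows "twisted (inv\<^bsub>D.Z\<^esub> c) (inv\<^bsub>supported\<^esub> A)"
  unfolding twisted_def
proof (intro ballI)
  fix g x y assume *: "g \<in> carrier G" "x \<in> X" "y \<in> Y"
  show "(inv\<^bsub>supported\<^esub> A) x y = fst ((inv\<^bsub>D.Z\<^esub> c) g) x *
      (inv\<^bsub>supported\<^esub> A) (\<phi> (inv\<^bsub>G\<^esub> g) x) (\<psi> (inv\<^bsub>G\<^esub> g) y) * cnj (snd ((inv\<^bsub>D.Z\<^esub> c) g) y)"
    using * assms twistedD[OF assms(1) *]
    by (simp add: inv_supported inv_cocycle_entries)
qed

text \<open>
  A pushed cocycle multiplies each entry by $\zeta\overline{\zeta} = 1$, so it does not affect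
  the twist. This is why classes are taken modulo the image of \<open>Delta\<close>.
\<close>

lemma twisted_push:
  assumes z: "z \<in> carrier mu.Z"
  shows "twisted (c \<otimes>\<^bsub>D.Z\<^esub> Delta.push z) A \<longleftrightarrow> twisted c A"
proof -
  have "fst ((c \<otimes>\<^bsub>D.Z\<^esub> Delta.push z) g) x * a * cnj (snd ((c \<otimes>\<^bsub>D.Z\<^esub> Delta.push z) g) y)
      = fst (c g) x * a * cnj (snd (c g) y)" if "g \<in> carrier G" "x \<in> X" "y \<in> Y" for g x y a
  proof -
    have "fst (c g) x * z g * a * cnj (snd (c g) y * z g)
        = fst (c g) x * a * cnj (snd (c g) y) * (z g * cnj (z g))" by (simp add: mult_ac)
    then show ?thesis
      using that mu.cocycle_closed[OF z] n by (simp add: cocycle_entries push_entries mu_mult_cnj)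
  qed
  then show ?thesis
    unfolding twisted_def by (intro ball_cong refl) (simp only:)
qed

text \<open>
  Conversely, by irreducibility, only pushed cocycles leave all twists unchanged: if \<open>e\<close>
  fixes the characteristic matrix of \<open>\<O>\<close>, then its two components agree along every edge of the bipartite graph. By
  connectedness they are one constant \<open>z g\<close> for each \<open>g\<close>, and the cocycle identity at any vertex makes
  \<open>z\<close> a homomorphism.
\<close>

lemma twisted_one_imp_push:
  assumes e: "e \<in> carrier D.Z" and tw: "twisted e \<one>\<^bsub>supported\<^esub>"
  obtains z where "z \<in> carrier mu.Z" "e = Delta.push z"
proof -
  have eq: "fst (e g) x = snd (e g) y" if g: "g \<in> carrier G" and xy: "(x, y) \<in> \<O>" for g x y
  proof -
    have xy': "x \<in> X" "y \<in> Y" using xy O_subset by auto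
    have "(\<phi> (inv\<^bsub>G\<^esub> g) x, \<psi> (inv\<^bsub>G\<^esub> g) y) \<in> \<O>"
      using O.closed[of "inv\<^bsub>G\<^esub> g" "(x, y)"] g xy by (simp add: pair_act_def)
    then have one: "fst (e g) x * cnj (snd (e g) y) = 1"
      using twistedD[OF tw g xy'] xy by (simp add: one_supported)
    have "fst (e g) x = fst (e g) x * (cnj (snd (e g) y) * snd (e g) y)"
      using mu_mult_cnj(2)[OF n cocycle_closed(2)[OF e g xy'(2)]] by simp
    also have "\<dots> = snd (e g) y"
      using one by (simp only: mult.assoc[symmetric] mult_1_left)
    finally show ?thesis .
  qed
  have "\<exists>z. (\<forall>g\<in>carrier G. (\<forall>x\<in>X. fst (e g) x = z g) \<and> (\<forall>y\<in>Y. snd (e g) y = z g))"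
  proof -
    have "\<exists>\<zeta>. (\<forall>x\<in>X. fst (e g) x = \<zeta>) \<and> (\<forall>y\<in>Y. snd (e g) y = \<zeta>)" if "g \<in> carrier G" for g
      using irreducible_constant[of "fst (e g)" "snd (e g)"] eq[OF that] by metis
    then show ?thesis by metis
  qed
  then obtain z where zX: "\<And>g x. g \<in> carrier G \<Longrightarrow> x \<in> X \<Longrightarrow> fst (e g) x = z g"
    and zY: "\<And>g y. g \<in> carrier G \<Longrightarrow> y \<in> Y \<Longrightarrow> snd (e g) y = z g"
    by metis
  have zmu: "z g \<in> mu n" and zmult: "h \<in> carrier G \<Longrightarrow> z (g \<otimes>\<^bsub>G\<^esub> h) = z g * z h"
    if g: "g \<in> carrier G" for g h
  proof -
    from vertex_exists consider x where "x \<in> X" | y where "y \<in> Y" by blast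
    then have "z g \<in> mu n \<and> (h \<in> carrier G \<longrightarrow> z (g \<otimes>\<^bsub>G\<^esub> h) = z g * z h)"
    proof cases
      case 1
      have "fst (e g) x \<in> mu n" using e g 1 by simp
      moreover have "fst (e (g \<otimes>\<^bsub>G\<^esub> h)) x = fst (e g) x * fst (e h) (\<phi> (inv\<^bsub>G\<^esub> g) x)"
        if "h \<in> carrier G" using cocycle_mult(1)[OF e g that 1] .
      ultimately show ?thesis using g 1 by (simp add: zX)
    next
      case 2
      have "snd (e g) y \<in> mu n" using e g 2 by simp
      moreover have "snd (e (g \<otimes>\<^bsub>G\<^esub> h)) y = snd (e g) y * snd (e h) (\<psi> (inv\<^bsub>G\<^esub> g) y)"
        if "h \<in> carrier G" using cocycle_mult(2)[OF e g that 2] .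
      ultimately show ?thesis using g 2 by (simp add: zY)
    qed
    then show "z g \<in> mu n" "h \<in> carrier G \<Longrightarrow> z (g \<otimes>\<^bsub>G\<^esub> h) = z g * z h" by blast+
  qed
  show thesis
  proof
    show "restrict z (carrier G) \<in> carrier mu.Z"
      by (rule mu.cocycleI) (simp_all add: zmu zmult trivial_act_def)
    have mem: "fst (e g) \<in> X \<rightarrow>\<^sub>E mu n" "snd (e g) \<in> Y \<rightarrow>\<^sub>E mu n" if "g \<in> carrier G" for g
      using D.cocycle_closed[OF e that] by (simp_all add: mem_Times_iff)
    show "e = Delta.push (restrict z (carrier G))"
    proof (rule extensionalityI[of _ "carrier G"])
      show "e \<in> extensional (carrier G)" using e by (auto simp: D.carrier_Z PiE_iff)
      show "Delta.push (restrict z (carrier G)) \<in> extensional (carrier G)"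
        by (simp add: Delta.push_def)
      show "e g = Delta.push (restrict z (carrier G)) g" if g: "g \<in> carrier G" for g
      proof (rule prod_eqI)
        show "fst (e g) = fst (Delta.push (restrict z (carrier G)) g)"
          using mem(1)[OF g] g
          by (intro extensionalityI[of _ X]) (auto simp: PiE_iff Delta.push_def Delta_def zX)
        show "snd (e g) = snd (Delta.push (restrict z (carrier G)) g)"
          using mem(2)[OF g] g
          by (intro extensionalityI[of _ Y]) (auto simp: PiE_iff Delta.push_def Delta_def zY)
      qed
    qed
  qed
qed

lemma quot_push:
  assumes "z \<in> carrier mu.Z" "m \<in> carrier (mu_sum n X Y)"
  shows "Delta.quot (D.coboundary m \<otimes>\<^bsub>D.Z\<^esub> Delta.push z) = \<one>\<^bsub>Delta.coker\<^esub>"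
  using assms by (subst Delta.quot_eq_one_iff) (auto simp: D.coboundary_closed Delta.push_closed simp del: mu_sum_simps)

text \<open>
  If \<open>c\<close> and \<open>d\<close> twist the same matrix, then \<open>c / d\<close> twists \<open>A / A\<close>, the characteristic matrix,
  and is therefore diagonal.
\<close>

lemma quot_eqI:
  assumes A: "A \<in> carrier supported"
    and c: "c \<in> carrier D.Z" "twisted c A" and d: "d \<in> carrier D.Z" "twisted d A"
  shows "Delta.quot c = Delta.quot d"
proof -
  let ?e = "c \<otimes>\<^bsub>D.Z\<^esub> inv\<^bsub>D.Z\<^esub> d"
  have "twisted ?e \<one>\<^bsub>supported\<^esub>"
    using twisted_mult[OF c(2) twisted_inv[OF d(2,1) A]] A by simp
  then obtain z where z: "z \<in> carrier mu.Z" "?e = Delta.push z"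
    using twisted_one_imp_push[of ?e] c d by auto
  have "D.coboundary \<one>\<^bsub>mu_sum n X Y\<^esub> = \<one>\<^bsub>D.Z\<^esub>"
    by (rule hom_one[OF D.coboundary_hom D.M.is_group D.Z.is_group])
  then have "Delta.quot ?e = \<one>\<^bsub>Delta.coker\<^esub>"
    using quot_push[OF z(1) D.M.one_closed] z Delta.push_closed by (simp del: mu_sum_simps)
  then show ?thesis
    using c d by (simp add: Delta.quot.H.inv_solve_right' del: one_FactGroup mult_FactGroup)
qed

definition kappa where
  "kappa A = Delta.quot (SOME c. c \<in> carrier D.Z \<and> twisted c A)"

lemma kappa_eq:
  assumes "A \<in> carrier supported" "c \<in> carrier D.Z" "twisted c A"
  shows "kappa A = Delta.quot c"
  unfolding kappa_def
  by (rule someI2[of _ c]) (use assms quot_eqI in blast)+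

section \<open>The groups of invariant and cover-invariant matrices\<close>

lemma cover_of_cocycle_eq:
  "cover_of_cocycle X \<phi> Y \<psi> c g = (X.signed_perm (fst (c g)) g, Y.signed_perm (snd (c g)) g)"
  by (simp add: cover_of_cocycle_def X.signed_perm_def Y.signed_perm_def)

lemma monomial_cover_of_cocycle:
  assumes c: "c \<in> carrier D.Z"
  shows "monomial_cover G n X \<phi> Y \<psi> (cover_of_cocycle X \<phi> Y \<psi> c)"
  unfolding monomial_cover_def
proof (intro conjI ballI homI)
  fix g assume g: "g \<in> carrier G"
  show "cover_of_cocycle X \<phi> Y \<psi> c g \<in> carrier (Mon n X \<times>\<times> Mon n Y)"
    using c g finite_X finite_Y n
    by (simp add: cover_of_cocycle_eq X.signed_perm_Mon Y.signed_perm_Mon)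
  show "entry_abs (fst (cover_of_cocycle X \<phi> Y \<psi> c g)) = perm_matrix X \<phi> g"
    "entry_abs (snd (cover_of_cocycle X \<phi> Y \<psi> c g)) = perm_matrix Y \<psi> g"
    using c g finite_X finite_Y n
    by (simp_all add: cover_of_cocycle_eq X.entry_abs_signed_perm Y.entry_abs_signed_perm)
  fix h assume h: "h \<in> carrier G"
  have "X.signed_perm (fst (c (g \<otimes>\<^bsub>G\<^esub> h))) (g \<otimes>\<^bsub>G\<^esub> h)
      = X.signed_perm (\<lambda>x. fst (c g) x * fst (c h) (\<phi> (inv\<^bsub>G\<^esub> g) x)) (g \<otimes>\<^bsub>G\<^esub> h)"
    "Y.signed_perm (snd (c (g \<otimes>\<^bsub>G\<^esub> h))) (g \<otimes>\<^bsub>G\<^esub> h)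
      = Y.signed_perm (\<lambda>y. snd (c g) y * snd (c h) (\<psi> (inv\<^bsub>G\<^esub> g) y)) (g \<otimes>\<^bsub>G\<^esub> h)"
    using finite_X finite_Y cocycle_mult[OF c g h]
    by (auto simp: fun_eq_iff X.signed_perm_entry Y.signed_perm_entry)
  then show "cover_of_cocycle X \<phi> Y \<psi> c (g \<otimes>\<^bsub>G\<^esub> h) = cover_of_cocycle X \<phi> Y \<psi> c g
      \<otimes>\<^bsub>Mon n X \<times>\<times> Mon n Y\<^esub> cover_of_cocycle X \<phi> Y \<psi> c h"
    using g h finite_X finite_Y
    by (simp add: cover_of_cocycle_eq Mon_def X.signed_perm_mult Y.signed_perm_mult)
qed

text \<open>
  Every monomial cover comes from a cocycle: its entries have absolute value $0$ or $1$ as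
  prescribed by the permutation matrices, and the signs are read off at the position
  \<open>(x, \<phi> (inv g) x)\<close>.
\<close>

lemma cocycle_of_monomial_cover:
  assumes s: "monomial_cover G n X \<phi> Y \<psi> s"
  obtains c where "c \<in> carrier D.Z" "\<And>g. g \<in> carrier G \<Longrightarrow> s g = cover_of_cocycle X \<phi> Y \<psi> c g"
proof -
  define c where "c = (\<lambda>g\<in>carrier G. (\<lambda>x\<in>X. fst (s g) x (\<phi> (inv\<^bsub>G\<^esub> g) x),
                                  \<lambda>y\<in>Y. snd (s g) y (\<psi> (inv\<^bsub>G\<^esub> g) y)))"
  have hom: "s \<in> hom G (Mon n X \<times>\<times> Mon n Y)"
    and absX: "\<And>g. g \<in> carrier G \<Longrightarrow> entry_abs (fst (s g)) = perm_matrix X \<phi> g"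
    and absY: "\<And>g. g \<in> carrier G \<Longrightarrow> entry_abs (snd (s g)) = perm_matrix Y \<psi> g"
    using s by (auto simp: monomial_cover_def)
  have mem: "fst (s g) \<in> mu_matrices n X X" "snd (s g) \<in> mu_matrices n Y Y" if "g \<in> carrier G" for g
    using hom_in_carrier[OF hom that] by (auto simp: Mon_def)
  have s_eq: "fst (s g) = X.signed_perm (fst (c g)) g" "snd (s g) = Y.signed_perm (snd (c g)) g"
    and c_mem: "fst (c g) \<in> X \<rightarrow>\<^sub>E mu n" "snd (c g) \<in> Y \<rightarrow>\<^sub>E mu n" if g: "g \<in> carrier G" for g
    using X.signed_permI[OF finite_X n g mem(1)[OF g] absX[OF g]]
      Y.signed_permI[OF finite_Y n g mem(2)[OF g] absY[OF g]] g
    by (simp_all add: c_def)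
  have s_mult: "fst (s (g \<otimes>\<^bsub>G\<^esub> h)) = mmult X (fst (s g)) (fst (s h))"
    "snd (s (g \<otimes>\<^bsub>G\<^esub> h)) = mmult Y (snd (s g)) (snd (s h))" if "g \<in> carrier G" "h \<in> carrier G" for g h
    using hom_mult[OF hom that] by (simp_all add: Mon_def DirProd_def case_prod_beta)
  show thesis
  proof
    show "c \<in> carrier D.Z"
    proof (rule D_cocycleI)
      fix g h assume g: "g \<in> carrier G" and h: "h \<in> carrier G"
      have gh: "g \<otimes>\<^bsub>G\<^esub> h \<in> carrier G" using g h by simp
      have X: "X.signed_perm (fst (c (g \<otimes>\<^bsub>G\<^esub> h))) (g \<otimes>\<^bsub>G\<^esub> h)
          = X.signed_perm (\<lambda>x. fst (c g) x * fst (c h) (\<phi> (inv\<^bsub>G\<^esub> g) x)) (g \<otimes>\<^bsub>G\<^esub> h)"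
        using s_mult(1)[OF g h] g h finite_X by (simp add: s_eq X.signed_perm_mult)
      show "fst (c (g \<otimes>\<^bsub>G\<^esub> h)) x = fst (c g) x * fst (c h) (\<phi> (inv\<^bsub>G\<^esub> g) x)" if "x \<in> X" for x
        using X.signed_perm_eqD[OF finite_X gh X that] .
      have Y: "Y.signed_perm (snd (c (g \<otimes>\<^bsub>G\<^esub> h))) (g \<otimes>\<^bsub>G\<^esub> h)
          = Y.signed_perm (\<lambda>y. snd (c g) y * snd (c h) (\<psi> (inv\<^bsub>G\<^esub> g) y)) (g \<otimes>\<^bsub>G\<^esub> h)"
        using s_mult(2)[OF g h] g h finite_Y by (simp add: s_eq Y.signed_perm_mult)
      show "snd (c (g \<otimes>\<^bsub>G\<^esub> h)) y = snd (c g) y * snd (c h) (\<psi> (inv\<^bsub>G\<^esub> g) y)" if "y \<in> Y" for y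
        using Y.signed_perm_eqD[OF finite_Y gh Y that] .
    qed (simp_all add: c_mem, simp add: c_def)
    show "s g = cover_of_cocycle X \<phi> Y \<psi> c g" if "g \<in> carrier G" for g
      using s_eq[OF that] by (simp add: cover_of_cocycle_eq prod_eq_iff)
  qed
qed

lemma cover_fixes_iff_twisted:
  assumes A: "A \<in> carrier supported"
  shows "(\<forall>g\<in>carrier G. mmult Y (mmult X (fst (cover_of_cocycle X \<phi> Y \<psi> c g)) A)
      (ctranspose (snd (cover_of_cocycle X \<phi> Y \<psi> c g))) = A) \<longleftrightarrow> twisted c A"
proof -
  have "mmult Y (mmult X (fst (cover_of_cocycle X \<phi> Y \<psi> c g)) A)
      (ctranspose (snd (cover_of_cocycle X \<phi> Y \<psi> c g))) = A \<longleftrightarrow>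
      (\<forall>x\<in>X. \<forall>y\<in>Y. A x y = fst (c g) x * A (\<phi> (inv\<^bsub>G\<^esub> g) x) (\<psi> (inv\<^bsub>G\<^esub> g) y) * cnj (snd (c g) y))"
    if g: "g \<in> carrier G" for g
    using supported_outside[OF A]
    by (auto simp: cover_of_cocycle_eq X.signed_perm_left[OF finite_X g]
        Y.signed_perm_right[OF finite_Y g] fun_eq_iff)
  then show ?thesis by (simp add: twisted_def)
qed

lemma supp_D_equiv:
  assumes "D_equiv n X Y A B" "B \<in> mu_matrices n X Y"
  shows "A \<in> mu_matrices n X Y" "supp A = supp B"
proof -
  obtain u v where u: "u \<in> X \<rightarrow> mu n" and v: "v \<in> Y \<rightarrow> mu n"
    and A: "A = (\<lambda>x y. if x \<in> X \<and> y \<in> Y then u x * B x y * cnj (v y) else 0)"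
    using assms(1) by (auto simp: D_equiv_iff[OF finite_X finite_Y])
  have "u x \<noteq> 0" "v y \<noteq> 0" if "x \<in> X" "y \<in> Y" for x y
    using u v that mu_nonzero[OF n] by blast+
  then show "supp A = supp B"
    using assms(2) by (auto simp: A supp_def mu_matrices_def)
  have "u x * B x y * cnj (v y) \<in> mu_plus n" if "x \<in> X" "y \<in> Y" for x y
  proof -
    have "u x \<in> mu n" "v y \<in> mu n" "B x y \<in> mu_plus n"
      using u v that assms(2) by (auto simp: mu_matrices_def)
    then show ?thesis by (auto simp: mu_plus_def)
  qed
  then show "A \<in> mu_matrices n X Y"
    by (simp add: A mu_matrices_def)
qed

lemma carrier_hh:
  "A \<in> carrier (hh G n X \<phi> Y \<psi> \<O>) \<longleftrightarrow>
     A \<in> carrier supported \<and> (\<forall>g\<in>carrier G. D_equiv n X Y A (mat_act G X \<phi> Y \<psi> g A))"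
  by (simp add: hh_def supported_def D_equiv_def)

text \<open>
  The two components of \<open>c g\<close> are the diagonal matrices $L(g)$ and $R(g)$ that membership in
  $\mathbf h$ asks for.
\<close>

lemma twisted_imp_hh:
  assumes A: "A \<in> carrier supported" and c: "c \<in> carrier D.Z" "twisted c A"
  shows "A \<in> carrier (hh G n X \<phi> Y \<psi> \<O>)"
  unfolding carrier_hh
proof (intro conjI A ballI)
  fix g assume g: "g \<in> carrier G"
  have "A x y = (if x \<in> X \<and> y \<in> Y
      then fst (c g) x * mat_act G X \<phi> Y \<psi> g A x y * cnj (snd (c g) y) else 0)" for x y
    using twistedD[OF c(2) g, of x y] supported_outside[OF A, of x y] by (simp add: mat_act_def)
  then show "D_equiv n X Y A (mat_act G X \<phi> Y \<psi> g A)"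
    unfolding D_equiv_iff[OF finite_X finite_Y] using c(1) g
    by (intro bexI[of _ "fst (c g)"] bexI[of _ "snd (c g)"] ext) auto
qed

lemma carrier_hh1:
  "A \<in> carrier (hh1 G n X \<phi> Y \<psi> \<O>) \<longleftrightarrow>
     A \<in> carrier supported \<and> (\<exists>c\<in>carrier D.Z. twisted c A)"
proof
  assume "A \<in> carrier (hh1 G n X \<phi> Y \<psi> \<O>)"
  then obtain s where A: "A \<in> carrier supported" and s: "monomial_cover G n X \<phi> Y \<psi> s"
    and fix_A: "\<forall>g\<in>carrier G. mmult Y (mmult X (fst (s g)) A) (ctranspose (snd (s g))) = A"
    by (auto simp: hh1_def carrier_hh)
  obtain c where c: "c \<in> carrier D.Z" "\<And>g. g \<in> carrier G \<Longrightarrow> s g = cover_of_cocycle X \<phi> Y \<psi> c g"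
    using cocycle_of_monomial_cover[OF s] by metis
  then have "twisted c A"
    using fix_A by (simp flip: cover_fixes_iff_twisted[OF A])
  with A c(1) show "A \<in> carrier supported \<and> (\<exists>c\<in>carrier D.Z. twisted c A)" by blast
next
  assume "A \<in> carrier supported \<and> (\<exists>c\<in>carrier D.Z. twisted c A)"
  then obtain c where A: "A \<in> carrier supported" and c: "c \<in> carrier D.Z" "twisted c A" by blast
  show "A \<in> carrier (hh1 G n X \<phi> Y \<psi> \<O>)"
    using twisted_imp_hh[OF A c] monomial_cover_of_cocycle[OF c(1)]
      cover_fixes_iff_twisted[OF A, of c] c(2)
    by (auto simp: hh1_def)
qed

text \<open>
  Rescaling rows and columns by \<open>m\<close> changes the twist by the coboundary of \<open>m\<close>. So being
  $D$-equivalent to an invariant matrix is being twisted by a coboundary, which puts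
  $\mathbf h^0$ and $\mathbf h^1$ on the same footing.
\<close>

lemma D_equiv_invariant_iff:
  assumes A: "A \<in> carrier supported"
  shows "(\<exists>B\<in>mu_matrices n X Y. D_equiv n X Y A B \<and> (\<forall>g\<in>carrier G. mat_act G X \<phi> Y \<psi> g B = B))
    \<longleftrightarrow> (\<exists>m\<in>carrier (mu_sum n X Y). twisted (D.coboundary m) A)"
proof
  assume "\<exists>B\<in>mu_matrices n X Y. D_equiv n X Y A B \<and> (\<forall>g\<in>carrier G. mat_act G X \<phi> Y \<psi> g B = B)"
  then obtain B u v where u: "u \<in> X \<rightarrow> mu n" and v: "v \<in> Y \<rightarrow> mu n"
    and A_eq: "A = (\<lambda>x y. if x \<in> X \<and> y \<in> Y then u x * B x y * cnj (v y) else 0)"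
    and B: "\<And>g. g \<in> carrier G \<Longrightarrow> mat_act G X \<phi> Y \<psi> g B = B"
    by (auto simp: D_equiv_iff[OF finite_X finite_Y])
  let ?m = "(\<lambda>x\<in>X. cnj (u x), \<lambda>y\<in>Y. cnj (v y))"
  have m: "?m \<in> carrier (mu_sum n X Y)" using u v by (auto intro!: mu_cnj)
  have "twisted (D.coboundary ?m) A"
    unfolding twisted_def
  proof (intro ballI)
    fix g x y assume g: "g \<in> carrier G" and x: "x \<in> X" and y: "y \<in> Y"
    let ?x = "\<phi> (inv\<^bsub>G\<^esub> g) x" and ?y = "\<psi> (inv\<^bsub>G\<^esub> g) y"
    have xy: "?x \<in> X" "?y \<in> Y" using g x y by simp_all
    then have unit: "cnj (u ?x) * u ?x = 1" "cnj (v ?y) * v ?y = 1"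
      using u v mu_mult_cnj(2)[OF n] by blast+
    have B_xy: "B x y = B ?x ?y"
      using fun_cong[OF fun_cong[OF B[OF g]], of x y] x y by (simp add: mat_act_def)
    have "fst (D.coboundary ?m g) x * A ?x ?y * cnj (snd (D.coboundary ?m g) y)
        = (cnj (u ?x) * u ?x) * (cnj (v ?y) * v ?y) * (u x * B ?x ?y * cnj (v y))"
      using g x y xy m by (simp add: A_eq coboundary_entries mult_ac)
    then show "A x y = fst (D.coboundary ?m g) x * A ?x ?y * cnj (snd (D.coboundary ?m g) y)"
      using x y B_xy unit by (simp add: A_eq)
  qed
  with m show "\<exists>m\<in>carrier (mu_sum n X Y). twisted (D.coboundary m) A" by blast
next
  assume "\<exists>m\<in>carrier (mu_sum n X Y). twisted (D.coboundary m) A"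
  then obtain m where m: "m \<in> carrier (mu_sum n X Y)" and tw: "twisted (D.coboundary m) A" by blast
  have muX: "fst m x \<in> mu n" if "x \<in> X" for x
    using m that by (auto simp: mem_Times_iff)
  have muY: "snd m y \<in> mu n" if "y \<in> Y" for y
    using m that by (auto simp: mem_Times_iff)
  define B where "B x y = (if x \<in> X \<and> y \<in> Y then fst m x * A x y * cnj (snd m y) else 0)" for x y
  have BA: "D_equiv n X Y B A"
    unfolding D_equiv_iff[OF finite_X finite_Y] B_def[abs_def]
    using muX muY by (intro bexI[of _ "fst m"] bexI[of _ "snd m"]) auto
  have Am: "A \<in> mu_matrices n X Y" using A by (simp add: supported_def)
  have B: "B \<in> mu_matrices n X Y" by (rule supp_D_equiv[OF BA Am])
  have "A x y = (if x \<in> X \<and> y \<in> Y then cnj (fst m x) * B x y * cnj (cnj (snd m y)) else 0)" for x y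
  proof (cases "x \<in> X \<and> y \<in> Y")
    case True
    then have "cnj (fst m x) * B x y * cnj (cnj (snd m y))
        = (cnj (fst m x) * fst m x) * (cnj (snd m y) * snd m y) * A x y"
      by (simp add: B_def mult_ac)
    with True muX muY n show ?thesis by (simp add: mu_mult_cnj)
  qed (auto simp: supported_outside[OF A])
  then have "D_equiv n X Y A B"
    unfolding D_equiv_iff[OF finite_X finite_Y]
    using muX muY
    by (intro bexI[of _ "\<lambda>x. cnj (fst m x)"] bexI[of _ "\<lambda>y. cnj (snd m y)"] ext) auto
  moreover have "mat_act G X \<phi> Y \<psi> g B = B" if g: "g \<in> carrier G" for g
  proof (intro ext)
    fix x y
    show "mat_act G X \<phi> Y \<psi> g B x y = B x y"
    proof (cases "x \<in> X \<and> y \<in> Y")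
      case True
      then have x: "x \<in> X" and y: "y \<in> Y" by blast+
      let ?x = "\<phi> (inv\<^bsub>G\<^esub> g) x" and ?y = "\<psi> (inv\<^bsub>G\<^esub> g) y"
      have xy: "?x \<in> X" "?y \<in> Y" using g x y by simp_all
      have "B x y = fst m x * (fst m ?x * cnj (fst m x) * A ?x ?y * cnj (snd m ?y * cnj (snd m y)))
          * cnj (snd m y)"
        using x y by (simp add: B_def twistedD[OF tw g x y] coboundary_entries[OF m g])
      also have "\<dots> = (fst m x * cnj (fst m x)) * (snd m y * cnj (snd m y)) * B ?x ?y"
        using xy by (simp add: B_def mult_ac)
      also have "\<dots> = B ?x ?y"
        using muX[OF x] muY[OF y] n by (simp add: mu_mult_cnj)
      finally show ?thesis using x y by (simp add: mat_act_def)
    qed (auto simp: mat_act_def B_def)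
  qed
  ultimately show "\<exists>B\<in>mu_matrices n X Y. D_equiv n X Y A B \<and> (\<forall>g\<in>carrier G. mat_act G X \<phi> Y \<psi> g B = B)"
    using B by blast
qed

lemma carrier_hh0:
  "A \<in> carrier (hh0 G n X \<phi> Y \<psi> \<O>) \<longleftrightarrow>
     A \<in> carrier supported \<and> (\<exists>m\<in>carrier (mu_sum n X Y). twisted (D.coboundary m) A)"
proof -
  have "A \<in> carrier (hh G n X \<phi> Y \<psi> \<O>)"
    if "A \<in> carrier supported" "m \<in> carrier (mu_sum n X Y)" "twisted (D.coboundary m) A" for m
    using that D.coboundary_closed twisted_imp_hh by blast
  then show ?thesis
    using D_equiv_invariant_iff[of A] by (auto simp: hh0_def carrier_hh)
qed

lemma hh1_eq: "hh1 G n X \<phi> Y \<psi> \<O> = supported\<lparr>carrier := carrier (hh1 G n X \<phi> Y \<psi> \<O>)\<rparr>"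
  by (simp add: hh1_def hh_def supported_def)

lemma hh0_eq: "hh0 G n X \<phi> Y \<psi> \<O>
    = (hh1 G n X \<phi> Y \<psi> \<O>)\<lparr>carrier := carrier (hh0 G n X \<phi> Y \<psi> \<O>)\<rparr>"
  by (simp add: hh0_def hh1_def hh_def)

lemma group_hh1: "Group.group (hh1 G n X \<phi> Y \<psi> \<O>)"
proof -
  have "subgroup (carrier (hh1 G n X \<phi> Y \<psi> \<O>)) supported"
  proof (rule supported.subgroupI)
    have "twisted \<one>\<^bsub>D.Z\<^esub> \<one>\<^bsub>supported\<^esub>"
      unfolding twisted_def
    proof (intro ballI)
      fix g x y assume *: "g \<in> carrier G" "x \<in> X" "y \<in> Y"
      show "\<one>\<^bsub>supported\<^esub> x y = fst (\<one>\<^bsub>D.Z\<^esub> g) x *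
          \<one>\<^bsub>supported\<^esub> (\<phi> (inv\<^bsub>G\<^esub> g) x) (\<psi> (inv\<^bsub>G\<^esub> g) y) * cnj (snd (\<one>\<^bsub>D.Z\<^esub> g) y)"
        using * inv_mem_O_iff[OF *] by (simp add: one_supported D.one_Z)
    qed
    then show "carrier (hh1 G n X \<phi> Y \<psi> \<O>) \<noteq> {}"
      using carrier_hh1 supported.one_closed D.Z.one_closed by blast
    show "inv\<^bsub>supported\<^esub> A \<in> carrier (hh1 G n X \<phi> Y \<psi> \<O>)"
      if "A \<in> carrier (hh1 G n X \<phi> Y \<psi> \<O>)" for A
      using that twisted_inv D.Z.inv_closed supported.inv_closed unfolding carrier_hh1 by metis
    show "A \<otimes>\<^bsub>supported\<^esub> B \<in> carrier (hh1 G n X \<phi> Y \<psi> \<O>)"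
      if "A \<in> carrier (hh1 G n X \<phi> Y \<psi> \<O>)" "B \<in> carrier (hh1 G n X \<phi> Y \<psi> \<O>)" for A B
      using that twisted_mult D.Z.m_closed supported.m_closed unfolding carrier_hh1 by metis
  qed (auto simp: carrier_hh1)
  then show ?thesis
    using subgroup.subgroup_is_group[OF _ supported.is_group] hh1_eq by metis
qed

text \<open>
  Twists multiply along with the matrices, so sending a matrix to the class of any of its twists is
  a homomorphism.
\<close>

sublocale kappa: group_hom "hh1 G n X \<phi> Y \<psi> \<O>" Delta.coker kappa
proof (intro group_hom.intro group_hom_axioms.intro group_hh1 Delta.quot.H.is_group homI)
  show "kappa A \<in> carrier Delta.coker" if "A \<in> carrier (hh1 G n X \<phi> Y \<psi> \<O>)" for A
    using that kappa_eq Delta.quot.hom_closed unfolding carrier_hh1 by metis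
  show "kappa (A \<otimes>\<^bsub>hh1 G n X \<phi> Y \<psi> \<O>\<^esub> B) = kappa A \<otimes>\<^bsub>Delta.coker\<^esub> kappa B"
    if AB: "A \<in> carrier (hh1 G n X \<phi> Y \<psi> \<O>)" "B \<in> carrier (hh1 G n X \<phi> Y \<psi> \<O>)" for A B
  proof -
    obtain c d where c: "c \<in> carrier D.Z" "twisted c A" and d: "d \<in> carrier D.Z" "twisted d B"
      and A: "A \<in> carrier supported" and B: "B \<in> carrier supported"
      using AB unfolding carrier_hh1 by blast
    have "A \<otimes>\<^bsub>hh1 G n X \<phi> Y \<psi> \<O>\<^esub> B = A \<otimes>\<^bsub>supported\<^esub> B"
      by (subst hh1_eq) simp
    then have "kappa (A \<otimes>\<^bsub>hh1 G n X \<phi> Y \<psi> \<O>\<^esub> B) = Delta.quot (c \<otimes>\<^bsub>D.Z\<^esub> d)"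
      using kappa_eq[OF _ _ twisted_mult[OF c(2) d(2)]] A B c d by simp
    then show ?thesis
      using kappa_eq[OF A c] kappa_eq[OF B d] c d by simp
  qed
qed

lemma kernel_kappa:
  "Coset.kernel (hh1 G n X \<phi> Y \<psi> \<O>) Delta.coker kappa = carrier (hh0 G n X \<phi> Y \<psi> \<O>)"
proof (intro equalityI subsetI)
  fix A assume "A \<in> Coset.kernel (hh1 G n X \<phi> Y \<psi> \<O>) Delta.coker kappa"
  then have A1: "A \<in> carrier (hh1 G n X \<phi> Y \<psi> \<O>)" and k: "kappa A = \<one>\<^bsub>Delta.coker\<^esub>"
    by (simp_all add: Coset.kernel_def)
  obtain c where A: "A \<in> carrier supported" and c: "c \<in> carrier D.Z" "twisted c A"
    using A1 unfolding carrier_hh1 by blast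
  have "Delta.quot c = \<one>\<^bsub>Delta.coker\<^esub>"
    using k kappa_eq[OF A c] by simp
  then obtain m z where mz: "m \<in> carrier (mu_sum n X Y)" "z \<in> carrier mu.Z"
    "c = D.coboundary m \<otimes>\<^bsub>D.Z\<^esub> Delta.push z"
    unfolding Delta.quot_eq_one_iff[OF c(1)] by blast
  then have "twisted (D.coboundary m) A"
    using c(2) twisted_push by simp
  then show "A \<in> carrier (hh0 G n X \<phi> Y \<psi> \<O>)"
    using A mz(1) unfolding carrier_hh0 by blast
next
  fix A assume "A \<in> carrier (hh0 G n X \<phi> Y \<psi> \<O>)"
  then obtain m where A: "A \<in> carrier supported" and m: "m \<in> carrier (mu_sum n X Y)"
    and tw: "twisted (D.coboundary m) A"
    unfolding carrier_hh0 by blast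
  note dm = D.coboundary_closed[OF m]
  have "D.coboundary m \<otimes>\<^bsub>D.Z\<^esub> Delta.push \<one>\<^bsub>mu.Z\<^esub> = D.coboundary m"
    using dm hom_one[OF Delta.push_hom mu.Z.is_group D.Z.is_group] by simp
  then have "kappa A = \<one>\<^bsub>Delta.coker\<^esub>"
    using kappa_eq[OF A dm tw] quot_push[OF mu.Z.one_closed m] by simp
  then show "A \<in> Coset.kernel (hh1 G n X \<phi> Y \<psi> \<O>) Delta.coker kappa"
    using A dm tw unfolding Coset.kernel_def carrier_hh1 by blast
qed

lemma group_hh0: "Group.group (hh0 G n X \<phi> Y \<psi> \<O>)"
  using subgroup.subgroup_is_group[OF kappa.subgroup_kernel group_hh1]
  by (simp add: kernel_kappa flip: hh0_eq)

section \<open>Orientability and the image\<close>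

definition orientable_cocycle where
  "orientable_cocycle c \<longleftrightarrow> (\<forall>(x, y)\<in>\<O>. \<forall>g\<in>carrier G.
     \<phi> g x = x \<and> \<psi> g y = y \<longrightarrow> fst (c g) x = snd (c g) y)"

lemma orbits_orientable_iff:
  assumes c: "c \<in> carrier D.Z"
  shows "(\<forall>orb \<in> orbits G \<O> (pair_act \<phi> \<psi>). orbit_orientable G \<phi> \<psi> (cover_of_cocycle X \<phi> Y \<psi> c) orb)
    \<longleftrightarrow> orientable_cocycle c"
proof -
  have union: "\<Union> (orbits G \<O> (pair_act \<phi> \<psi>)) = \<O>"
  proof (intro equalityI subsetI)
    fix p assume "p \<in> \<Union> (orbits G \<O> (pair_act \<phi> \<psi>))"
    then show "p \<in> \<O>" using O.closed by (auto simp: orbits_def orbit_def)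
  next
    fix p assume p: "p \<in> \<O>"
    then have "p \<in> orbit G (pair_act \<phi> \<psi>) p"
      using O.one[OF p] X.one_closed unfolding orbit_def by force
    then show "p \<in> \<Union> (orbits G \<O> (pair_act \<phi> \<psi>))" using p unfolding orbits_def by blast
  qed
  have sign: "row_sign x (fst (cover_of_cocycle X \<phi> Y \<psi> c g)) = fst (c g) x"
    "row_sign y (snd (cover_of_cocycle X \<phi> Y \<psi> c g)) = snd (c g) y"
    if "(x, y) \<in> \<O>" "g \<in> carrier G" for x y g
  proof -
    have xy: "x \<in> X" "y \<in> Y" using that O_subset by auto
    then have "fst (c g) x \<noteq> 0" "snd (c g) y \<noteq> 0"
      using cocycle_closed[OF c that(2)] mu_nonzero[OF n] by blast+
    then show "row_sign x (fst (cover_of_cocycle X \<phi> Y \<psi> c g)) = fst (c g) x"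
      "row_sign y (snd (cover_of_cocycle X \<phi> Y \<psi> c g)) = snd (c g) y"
      using xy that(2) finite_X finite_Y
      by (simp_all add: cover_of_cocycle_eq X.row_sign_signed_perm Y.row_sign_signed_perm)
  qed
  have "(\<forall>orb \<in> orbits G \<O> (pair_act \<phi> \<psi>). orbit_orientable G \<phi> \<psi> (cover_of_cocycle X \<phi> Y \<psi> c) orb)
      \<longleftrightarrow> (\<forall>p \<in> \<Union> (orbits G \<O> (pair_act \<phi> \<psi>)). orientable G \<phi> \<psi> (cover_of_cocycle X \<phi> Y \<psi> c) p)"
    unfolding orbit_orientable_def by blast
  also have "\<dots> \<longleftrightarrow> orientable_cocycle c"
    unfolding union orientable_cocycle_def orientable_def
    by (intro ball_cong refl) (auto simp: sign)
  finally show ?thesis .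
qed

text \<open>
  At a point fixed by \<open>g\<close> the twisting equation relates the entry \<open>A x y\<close> to itself; as it
  is nonzero, the two signs must coincide.
\<close>

lemma twisted_imp_orientable:
  assumes A: "A \<in> carrier supported" and c: "c \<in> carrier D.Z" "twisted c A"
  shows "orientable_cocycle c"
  unfolding orientable_cocycle_def
proof (clarify)
  fix x y g assume xy: "(x, y) \<in> \<O>" and g: "g \<in> carrier G" and fixed: "\<phi> g x = x" "\<psi> g y = y"
  have x: "x \<in> X" and y: "y \<in> Y" using xy O_subset by auto
  have inv: "\<phi> (inv\<^bsub>G\<^esub> g) x = x" "\<psi> (inv\<^bsub>G\<^esub> g) y = y"
    using X.inv_left[OF g x] Y.inv_left[OF g y] fixed by simp_all
  have "A x y = fst (c g) x * A x y * cnj (snd (c g) y)"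
    using twistedD[OF c(2) g x y] by (simp add: inv)
  then have "A x y * (fst (c g) x * cnj (snd (c g) y)) = A x y * 1"
    by (simp add: mult_ac)
  moreover have "A x y \<noteq> 0"
    using supported_entry[OF A xy] mu_nonzero[OF n] by blast
  ultimately have one: "fst (c g) x * cnj (snd (c g) y) = 1"
    using mult_left_cancel by blast
  have "fst (c g) x = fst (c g) x * (cnj (snd (c g) y) * snd (c g) y)"
    using mu_mult_cnj(2)[OF n cocycle_closed(2)[OF c(1) g y]] by simp
  also have "\<dots> = snd (c g) y"
    using one by (simp only: mult.assoc[symmetric] mult_1_left)
  finally show "fst (c g) x = snd (c g) y" .
qed

text \<open>
  This is Shapiro's lemma in degree one. On \<open>\<O>\<close> the function \<open>\<rho>\<close> is a cocycle with values in
  $\mu_n[\mathcal O]$, and orientability says that it is trivial on the stabilizer of every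
  point. Such a cocycle is a coboundary: put the value $1$ at the orbit representatives and
  transport it along the orbits.
\<close>

lemma orientable_imp_twisted:
  assumes c: "c \<in> carrier D.Z" and orient: "orientable_cocycle c"
  obtains A where "A \<in> carrier supported" "twisted c A"
proof -
  obtain r t where r: "\<And>p. p \<in> \<O> \<Longrightarrow> r p \<in> \<O>" and t: "\<And>p. p \<in> \<O> \<Longrightarrow> t p \<in> carrier G"
    and tr: "\<And>p. p \<in> \<O> \<Longrightarrow> pair_act \<phi> \<psi> (t p) (r p) = p"
    and r_act: "\<And>g p. g \<in> carrier G \<Longrightarrow> p \<in> \<O> \<Longrightarrow> r (pair_act \<phi> \<psi> g p) = r p"
    using O.orbit_representatives by metis
  define \<rho> where "\<rho> g p = fst (c g) (fst p) * cnj (snd (c g) (snd p))" for g p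
  have mu: "\<rho> g p \<in> mu n" if "g \<in> carrier G" "p \<in> \<O>" for g p
    using that O_subset cocycle_closed[OF c that(1)] by (auto simp: \<rho>_def)
  have \<rho>_mult: "\<rho> (g \<otimes>\<^bsub>G\<^esub> h) p = \<rho> g p * \<rho> h (pair_act \<phi> \<psi> (inv\<^bsub>G\<^esub> g) p)"
    if "g \<in> carrier G" "h \<in> carrier G" "p \<in> \<O>" for g h p
    using that O_subset cocycle_mult[OF c that(1,2)] by (auto simp: \<rho>_def pair_act_def)
  have \<rho>_stab: "\<rho> k p = 1" if "k \<in> carrier G" "p \<in> \<O>" "pair_act \<phi> \<psi> k p = p" for k p
  proof -
    obtain x y where p: "p = (x, y)" by fastforce
    then have "fst (c k) x = snd (c k) y"
      using orient that by (auto simp: orientable_cocycle_def pair_act_def)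
    moreover have "y \<in> Y" using p that(2) O_subset by auto
    ultimately show ?thesis
      using cocycle_closed(2)[OF c that(1)] n by (simp add: \<rho>_def p mu_mult_cnj)
  qed
  \<comment> \<open>The two ways \<open>t p\<close> and \<open>g \<otimes> t q\<close> of reaching \<open>p\<close> from the representative differ by a
     stabilizing element \<open>k\<close>, on which \<open>\<rho>\<close> is trivial.\<close>
  have step: "\<rho> (t p) p = \<rho> g p * \<rho> (t q) q"
    if g: "g \<in> carrier G" and p: "p \<in> \<O>" and q: "q = pair_act \<phi> \<psi> (inv\<^bsub>G\<^esub> g) p" for g p q
  proof -
    have qO: "q \<in> \<O>" using g p q by simp
    have rq: "r q = r p" using r_act g p by (simp add: q)
    define k where "k = inv\<^bsub>G\<^esub> (t p) \<otimes>\<^bsub>G\<^esub> (g \<otimes>\<^bsub>G\<^esub> t q)"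
    have k: "k \<in> carrier G" using g p qO t by (simp add: k_def)
    have home: "pair_act \<phi> \<psi> (inv\<^bsub>G\<^esub> (t p)) p = r p"
      using O.inv_left[OF t[OF p] r[OF p]] tr[OF p] by simp
    have "pair_act \<phi> \<psi> k (r p) = pair_act \<phi> \<psi> (inv\<^bsub>G\<^esub> (t p)) (pair_act \<phi> \<psi> g (pair_act \<phi> \<psi> (t q) (r q)))"
      using g p qO t r by (simp add: k_def O.mult rq)
    also have "\<dots> = r p"
      using tr[OF qO] g p home by (simp add: q)
    finally have "\<rho> k (r p) = 1" by (rule \<rho>_stab[OF k r[OF p]])
    moreover have "g \<otimes>\<^bsub>G\<^esub> t q = t p \<otimes>\<^bsub>G\<^esub> k"
      using g p qO t by (simp add: k_def X.inv_solve_left' flip: X.m_assoc)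
    ultimately show ?thesis
      using \<rho>_mult[OF t[OF p] k p] \<rho>_mult[OF g t[OF qO] p] home by (simp add: q)
  qed
  define A where "A x y = (if (x, y) \<in> \<O> then \<rho> (t (x, y)) (x, y) else 0)" for x y
  show thesis
  proof
    show "A \<in> carrier supported"
      using mu t by (simp add: carrier_supported A_def)
    show "twisted c A"
      unfolding twisted_def
    proof (intro ballI)
      fix g x y assume g: "g \<in> carrier G" and x: "x \<in> X" and y: "y \<in> Y"
      let ?x = "\<phi> (inv\<^bsub>G\<^esub> g) x" and ?y = "\<psi> (inv\<^bsub>G\<^esub> g) y"
      have mem: "(?x, ?y) \<in> \<O> \<longleftrightarrow> (x, y) \<in> \<O>" by (rule inv_mem_O_iff[OF g x y])
      show "A x y = fst (c g) x * A ?x ?y * cnj (snd (c g) y)"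
      proof (cases "(x, y) \<in> \<O>")
        case True
        then have "\<rho> (t (x, y)) (x, y) = \<rho> g (x, y) * \<rho> (t (?x, ?y)) (?x, ?y)"
          using step[OF g True, of "(?x, ?y)"] by (simp add: pair_act_def)
        then show ?thesis
          using True mem by (simp add: A_def \<rho>_def mult_ac)
      qed (simp add: A_def mem)
    qed
  qed
qed

text \<open>
  Orientability is required of all cocycles in a class, but it can be tested on one: a
  coboundary takes the value $1$ at fixed points.
\<close>

lemma orientable_classes_eq:
  "orientable_classes G n X \<phi> Y \<psi> \<O> = D.cls ` {c \<in> carrier D.Z. orientable_cocycle c}"
proof (intro equalityI subsetI)
  fix C assume C: "C \<in> orientable_classes G n X \<phi> Y \<psi> \<O>"
  then obtain c where c: "c \<in> carrier D.Z" "C = D.cls c"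
    by (auto simp: orientable_classes_def D.carrier_H)
  then have "c \<in> C"
    using D.Z.rcos_self[OF c(1) D.subgroup_B] by (simp add: D.cls_def)
  then have "orientable_cocycle c"
    using C orbits_orientable_iff[OF c(1)] by (simp add: orientable_classes_def)
  then show "C \<in> D.cls ` {c \<in> carrier D.Z. orientable_cocycle c}"
    using c by blast
next
  fix C assume "C \<in> D.cls ` {c \<in> carrier D.Z. orientable_cocycle c}"
  then obtain c where "C = D.cls c" and "c \<in> {c \<in> carrier D.Z. orientable_cocycle c}" by (rule imageE)
  then have c: "c \<in> carrier D.Z" "orientable_cocycle c" "C = D.cls c" by simp_all
  have "orientable_cocycle d \<and> d \<in> carrier D.Z" if d: "d \<in> C" for d
  proof -
    have "d \<in> D.cls c" using d c(3) by simp
    then obtain m where m: "m \<in> carrier (mu_sum n X Y)" "d = D.coboundary m \<otimes>\<^bsub>D.Z\<^esub> c"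
      unfolding D.mem_cls[OF c(1)] by (rule bexE)
    have "fst (d g) x = snd (d g) y"
      if xy: "(x, y) \<in> \<O>" and g: "g \<in> carrier G" and fixed: "\<phi> g x = x" "\<psi> g y = y" for x y g
    proof -
      have x: "x \<in> X" and y: "y \<in> Y" using xy O_subset by auto
      have inv: "\<phi> (inv\<^bsub>G\<^esub> g) x = x" "\<psi> (inv\<^bsub>G\<^esub> g) y = y"
        using X.inv_left[OF g x] Y.inv_left[OF g y] fixed by simp_all
      have mu: "fst m x \<in> mu n" "snd m y \<in> mu n"
        using m(1) x y by (auto simp: mem_Times_iff)
      have "fst (c g) x = snd (c g) y"
        using c(2) xy g fixed by (auto simp: orientable_cocycle_def)
      then show ?thesis
        using x y g mu n
        by (simp add: m(2) cocycle_entries coboundary_entries[OF m(1) g] inv mu_mult_cnj)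
    qed
    then have "orientable_cocycle d" by (auto simp: orientable_cocycle_def)
    moreover have "d \<in> carrier D.Z"
      unfolding m(2) by (rule D.Z.m_closed[OF D.coboundary_closed[OF m(1)] c(1)])
    ultimately show ?thesis by simp
  qed
  then show "C \<in> orientable_classes G n X \<phi> Y \<psi> \<O>"
    unfolding orientable_classes_def
    using c(1,3) orbits_orientable_iff by (simp add: D.carrier_H)
qed

lemma image_kappa:
  "kappa ` carrier (hh1 G n X \<phi> Y \<psi> \<O>) = Delta.quot ` {c \<in> carrier D.Z. orientable_cocycle c}"
proof (intro equalityI subsetI)
  fix k assume "k \<in> kappa ` carrier (hh1 G n X \<phi> Y \<psi> \<O>)"
  then obtain A c where "A \<in> carrier supported" "c \<in> carrier D.Z" "twisted c A" "k = kappa A"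
    by (auto simp: carrier_hh1)
  then show "k \<in> Delta.quot ` {c \<in> carrier D.Z. orientable_cocycle c}"
    using kappa_eq twisted_imp_orientable by blast
next
  fix k assume "k \<in> Delta.quot ` {c \<in> carrier D.Z. orientable_cocycle c}"
  then obtain c where "k = Delta.quot c" and "c \<in> {c \<in> carrier D.Z. orientable_cocycle c}" by (rule imageE)
  then have c: "c \<in> carrier D.Z" "orientable_cocycle c" "k = Delta.quot c" by simp_all
  obtain A where A: "A \<in> carrier supported" "twisted c A"
    by (rule orientable_imp_twisted[OF c(1,2)])
  then have "A \<in> carrier (hh1 G n X \<phi> Y \<psi> \<O>)" "k = kappa A"
    using c kappa_eq by (auto simp: carrier_hh1)
  then show "k \<in> kappa ` carrier (hh1 G n X \<phi> Y \<psi> \<O>)" by blast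
qed

section \<open>Invariant matrices with the given support\<close>

definition extend_zero :: "('x \<times> 'y \<Rightarrow> complex) \<Rightarrow> 'x \<Rightarrow> 'y \<Rightarrow> complex" where
  "extend_zero w x y = (if (x, y) \<in> \<O> then w (x, y) else 0)"

abbreviation "invariant_sums \<equiv> H0 G (mu_perm n \<O>) (perm_act G \<O> (pair_act \<phi> \<psi>))"

lemma extend_zero_image:
  "extend_zero ` carrier invariant_sums = {B \<in> carrier supported. \<forall>g\<in>carrier G. mat_act G X \<phi> Y \<psi> g B = B}"
proof (intro equalityI subsetI)
  fix B assume "B \<in> extend_zero ` carrier invariant_sums"
  then obtain w where w: "w \<in> \<O> \<rightarrow>\<^sub>E mu n" and B: "B = extend_zero w"
    and fix_w: "\<And>g. g \<in> carrier G \<Longrightarrow> perm_act G \<O> (pair_act \<phi> \<psi>) g w = w"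
    by (auto simp: H0_def)
  have "mat_act G X \<phi> Y \<psi> g B x y = B x y" if g: "g \<in> carrier G" for g x y
  proof (cases "(x, y) \<in> \<O>")
    case True
    then have "x \<in> X" "y \<in> Y" using O_subset by auto
    moreover have "w (\<phi> (inv\<^bsub>G\<^esub> g) x, \<psi> (inv\<^bsub>G\<^esub> g) y) = w (x, y)"
      using fun_cong[OF fix_w[OF g], of "(x, y)"] True by (simp add: perm_act_def pair_act_def)
    ultimately show ?thesis
      using True inv_mem_O_iff[OF g] by (simp add: mat_act_def B extend_zero_def)
  qed (use inv_mem_O_iff[OF g] in \<open>simp add: mat_act_def B extend_zero_def\<close>)
  moreover have "B \<in> carrier supported"
    using w by (auto simp: carrier_supported B extend_zero_def)
  ultimately show "B \<in> {B \<in> carrier supported. \<forall>g\<in>carrier G. mat_act G X \<phi> Y \<psi> g B = B}"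
    by (simp add: fun_eq_iff)
next
  fix B assume "B \<in> {B \<in> carrier supported. \<forall>g\<in>carrier G. mat_act G X \<phi> Y \<psi> g B = B}"
  then have B: "B \<in> carrier supported" and fix_B: "\<And>g. g \<in> carrier G \<Longrightarrow> mat_act G X \<phi> Y \<psi> g B = B"
    by simp_all
  let ?w = "\<lambda>p\<in>\<O>. B (fst p) (snd p)"
  have "perm_act G \<O> (pair_act \<phi> \<psi>) g ?w p = ?w p" if g: "g \<in> carrier G" for g p
  proof (cases "p \<in> \<O>")
    case True
    then obtain x y where p: "p = (x, y)" "x \<in> X" "y \<in> Y" using O_subset by auto
    have "B (\<phi> (inv\<^bsub>G\<^esub> g) x) (\<psi> (inv\<^bsub>G\<^esub> g) y) = B x y"
      using fun_cong[OF fun_cong[OF fix_B[OF g]], of x y] p by (simp add: mat_act_def)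
    then show ?thesis
      using True p inv_mem_O_iff[OF g] by (simp add: perm_act_def pair_act_def)
  qed (simp add: perm_act_def)
  moreover have "?w \<in> \<O> \<rightarrow>\<^sub>E mu n"
    using supported_entry[OF B] by auto
  ultimately have "?w \<in> carrier invariant_sums" by (simp add: H0_def fun_eq_iff)
  moreover have "extend_zero ?w = B"
    using supported_zero[OF B] by (simp add: fun_eq_iff extend_zero_def)
  ultimately show "B \<in> extend_zero ` carrier invariant_sums" by (metis image_eqI)
qed

lemma hh0_eq_D_closure:
  "carrier (hh0 G n X \<phi> Y \<psi> \<O>)
    = {A \<in> mu_matrices n X Y. \<exists>B\<in>extend_zero ` carrier invariant_sums. D_equiv n X Y A B}"
proof (intro equalityI subsetI)
  fix A assume "A \<in> carrier (hh0 G n X \<phi> Y \<psi> \<O>)"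
  then have A: "A \<in> carrier supported"
    and "\<exists>m\<in>carrier (mu_sum n X Y). twisted (D.coboundary m) A"
    unfolding carrier_hh0 by blast+
  then obtain B where B: "B \<in> mu_matrices n X Y" "D_equiv n X Y A B"
    "\<forall>g\<in>carrier G. mat_act G X \<phi> Y \<psi> g B = B"
    using D_equiv_invariant_iff[OF A] by blast
  then have "B \<in> carrier supported"
    using A supp_D_equiv[OF B(2,1)] by (simp add: supported_def)
  then have "B \<in> extend_zero ` carrier invariant_sums"
    using B(3) unfolding extend_zero_image by blast
  moreover have "A \<in> mu_matrices n X Y" using A by (simp add: supported_def)
  ultimately show "A \<in> {A \<in> mu_matrices n X Y. \<exists>B\<in>extend_zero ` carrier invariant_sums. D_equiv n X Y A B}"
    using B(2) by blast
next
  fix A assume "A \<in> {A \<in> mu_matrices n X Y. \<exists>B\<in>extend_zero ` carrier invariant_sums. D_equiv n X Y A B}"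
  then obtain B where AB: "D_equiv n X Y A B" and B: "B \<in> carrier supported"
    and fix_B: "\<forall>g\<in>carrier G. mat_act G X \<phi> Y \<psi> g B = B"
    unfolding extend_zero_image by blast
  have Bm: "B \<in> mu_matrices n X Y" using B by (simp add: supported_def)
  have A: "A \<in> carrier supported"
    using supp_D_equiv[OF AB Bm] B by (simp add: supported_def)
  then show "A \<in> carrier (hh0 G n X \<phi> Y \<psi> \<O>)"
    using AB Bm fix_B D_equiv_invariant_iff[OF A] unfolding carrier_hh0 by blast
qed

lemma D_equiv_refl: "B \<in> carrier supported \<Longrightarrow> D_equiv n X Y B B"
  unfolding D_equiv_iff[OF finite_X finite_Y]
  by (intro bexI[of _ "\<lambda>_. 1"] ext) (auto simp: supported_outside)

lemma extend_zero_hom: "group_hom invariant_sums (hh0 G n X \<phi> Y \<psi> \<O>) extend_zero"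
proof (intro group_hom.intro group_hom_axioms.intro group_hh0 homI)
  show "Group.group invariant_sums"
    by (rule g_module.group_H0[OF O.g_module_mu_perm[OF n]])
  show "extend_zero w \<in> carrier (hh0 G n X \<phi> Y \<psi> \<O>)" if "w \<in> carrier invariant_sums" for w
  proof -
    have "extend_zero w \<in> carrier supported"
      using imageI[OF that, of extend_zero] unfolding extend_zero_image by blast
    then show ?thesis
      using that D_equiv_refl unfolding hh0_eq_D_closure by (auto simp: supported_def)
  qed
  show "extend_zero (v \<otimes>\<^bsub>invariant_sums\<^esub> w) = extend_zero v \<otimes>\<^bsub>hh0 G n X \<phi> Y \<psi> \<O>\<^esub> extend_zero w" for v w
    by (simp add: H0_def hh0_def hh_def fun_eq_iff extend_zero_def)
qed

lemma inj_extend_zero: "inj_on extend_zero (carrier invariant_sums)"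
proof (rule inj_onI)
  fix v w assume "v \<in> carrier invariant_sums" "w \<in> carrier invariant_sums" and eq: "extend_zero v = extend_zero w"
  then have "v \<in> extensional \<O>" "w \<in> extensional \<O>" by (auto simp: H0_def PiE_iff)
  moreover have "v p = w p" if "p \<in> \<O>" for p
    using fun_cong[OF fun_cong[OF eq], of "fst p" "snd p"] that by (simp add: extend_zero_def)
  ultimately show "v = w" by (rule extensionalityI)
qed

end

section \<open>The two injections\<close>

theorem theorem3p12:
  fixes G :: "('g, 'a) monoid_scheme"
    and X :: "'x set" and \<phi> :: "'g \<Rightarrow> 'x \<Rightarrow> 'x"
    and Y :: "'y set" and \<psi> :: "'g \<Rightarrow> 'y \<Rightarrow> 'y"
    and n :: nat and \<O> :: "('x \<times> 'y) set"
  assumes "group G" and "finite (carrier G)"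
    and "finite X" and "transitive_action G X \<phi>"
    and "finite Y" and "transitive_action G Y \<psi>"
    and "n \<ge> 1"
    and "G_stable G \<phi> \<psi> \<O>" and "irreducible_subset X Y \<O>"
  shows
    "(\<exists>\<iota>. group_hom (H0 G (mu_perm n \<O>) (perm_act G \<O> (pair_act \<phi> \<psi>))) (hh0 G n X \<phi> Y \<psi> \<O>) \<iota> \<and>
          inj_on \<iota> (carrier (H0 G (mu_perm n \<O>) (perm_act G \<O> (pair_act \<phi> \<psi>)))) \<and>
          carrier (hh0 G n X \<phi> Y \<psi> \<O>) =
            {A \<in> mu_matrices n X Y.
               \<exists>B \<in> \<iota> ` carrier (H0 G (mu_perm n \<O>) (perm_act G \<O> (pair_act \<phi> \<psi>))).
                 D_equiv n X Y A B}) \<and>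
     (let h1_mod_h0 = hh1 G n X \<phi> Y \<psi> \<O> Mod carrier (hh0 G n X \<phi> Y \<psi> \<O>);
          H = H1 G (mu_sum n X Y) (sum_act G X \<phi> Y \<psi>);
          K = Delta_image G n X \<phi> Y \<psi>
      in \<exists>\<kappa>. group_hom h1_mod_h0 (H Mod K) \<kappa> \<and>
             inj_on \<kappa> (carrier h1_mod_h0) \<and>
             \<kappa> ` carrier h1_mod_h0 =
               generate (H Mod K) ((\<lambda>C. K #>\<^bsub>H\<^esub> C) ` orientable_classes G n X \<phi> Y \<psi> \<O>))"
proof -
  have actions: "group_action G X \<phi>" "group_action G Y \<psi>"
    using assms(4,6) by (simp_all add: transitive_action_def)
  interpret g_set_pair G X \<phi> Y \<psi> n \<O>
    using assms g_set_of_group_action[OF actions(1)] g_set_of_group_action[OF actions(2)]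
    by (simp add: g_set_pair_def g_set_pair_axioms_def)
  let ?h1 = "hh1 G n X \<phi> Y \<psi> \<O>" and ?h0 = "hh0 G n X \<phi> Y \<psi> \<O>"
  let ?\<kappa> = "\<lambda>C. the_elem (kappa ` C)"
  have K: "Delta_image G n X \<phi> Y \<psi> = Delta.Img"
    by (simp add: Delta_image_def)
  have "group_hom (?h1 Mod carrier ?h0) Delta.coker ?\<kappa>"
    using kappa.FactGroup_hom normal.factorgroup_is_group[OF kappa.normal_kernel]
      Delta.quot.H.is_group
    by (simp add: group_hom_def group_hom_axioms_def kernel_kappa)
  moreover have "inj_on ?\<kappa> (carrier (?h1 Mod carrier ?h0))"
    using kappa.FactGroup_inj_on by (simp add: kernel_kappa)
  moreover have "?\<kappa> ` carrier (?h1 Mod carrier ?h0)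
      = generate Delta.coker ((\<lambda>C. Delta.Img #>\<^bsub>H1 G (mu_sum n X Y) (sum_act G X \<phi> Y \<psi>)\<^esub> C) `
          orientable_classes G n X \<phi> Y \<psi> \<O>)"
  proof -
    have "(\<lambda>C. Delta.Img #>\<^bsub>H1 G (mu_sum n X Y) (sum_act G X \<phi> Y \<psi>)\<^esub> C) ` orientable_classes G n X \<phi> Y \<psi> \<O>
        = kappa ` carrier ?h1"
      by (simp add: orientable_classes_eq image_kappa image_image flip: Delta.quot_def)
    \<comment> \<open>The orientable classes already form a subgroup, being the image of a homomorphism.\<close>
    moreover have "generate Delta.coker (kappa ` carrier ?h1) = kappa ` carrier ?h1"
      by (rule Delta.quot.H.generate_subgroup[OF kappa.img_is_subgroup])
    moreover have "?\<kappa> ` carrier (?h1 Mod carrier ?h0) = kappa ` carrier ?h1"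
      using kappa.image_FactGroup_kernel by (simp add: kernel_kappa)
    ultimately show ?thesis by simp
  qed
  ultimately show ?thesis
    unfolding Let_def K
    using extend_zero_hom inj_extend_zero hh0_eq_D_closure by blast
qed

end
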